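(* Let $f=h+\overline{g}\in\mathcal{H}$ be a sense-preserving harmonic function in $\mathbb{D}$. Then the following statements are equivalent: (i) $f\in\mathcal{AK}_H$; (ii) $f\in\widetilde{\mathcal{AK}_H}$; (iii) for all $\zeta,b\in\mathbb{D}$ with $\zeta\neq b$, $$|h'(\zeta)|^2\left(1+|b|^2+\operatorname{Re}\left\{\frac{(\zeta-b)(1-\zeta\overline{b})h''(\zeta)}{h'(\zeta)}-2\overline{b}\zeta\right\}\right)\ \ge\ |g'(\zeta)|^2\left(1+|b|^2+\operatorname{Re}\left\{\frac{(\zeta-b)(1-\zeta\overline{b})g''(\zeta)}{g'(\zeta)}-2\overline{b}\zeta\right\}\right)+\operatorname{Re}\left\{\frac{(\zeta-b)^3(1-\zeta\overline{b})^3}{|\zeta-b|^2|1-\zeta\overline{b}|^2}\,\bigl[h''(\zeta)g'(\zeta)-h'(\zeta)g''(\zeta)\bigr]\right\},$$ where at points with $g'(\zeta)=0$ the product $|g'(\zeta)|^2\,\frac{g''(\zeta)}{g'(\zeta)}$ is read as $\overline{g'(\zeta)}\,g''(\zeta)=0$.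
   Context: $\mathbb{D}=\{z\in\mathbb{C}:|z|<1\}$. $\mathcal{H}$ is the class of complex-valued harmonic functions $f=h+\overline{g}$ in $\mathbb{D}$, with $h,g$ analytic in $\mathbb{D}$ and $h(z)=z+\sum_{n\ge2}a_nz^n$, $g(z)=\sum_{n\ge1}b_nz^n$. Such $f$ is sense-preserving in $\mathbb{D}$ if its Jacobian $J_f=|h'|^2-|g'|^2$ is positive in $\mathbb{D}$. For $a\in\mathbb{D}$, $r>0$, let $\mathbb{D}(a,r)=\{z\in\mathbb{D}:|z-a|<r\}$. $\mathcal{AK}_H$ (absolutely convex harmonic mappings) is the class of locally univalent $f\in\mathcal{H}$ such that $f(\mathbb{D}(a,r))$ is convex for all $a\in\mathbb{D}$ and all $r\in(0,1-|a|)$. $\widetilde{\mathcal{AK}_H}$ is the class of $f\in\mathcal{AK}_H$ such that $f(\mathbb{D}(a,r))$ is convex for all $a\in\mathbb{D}$ and all $r\in(0,1-|a|]$. *)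

theory Defs
  imports "HOL-Complex_Analysis.Complex_Analysis"
begin

abbreviation unit_disc :: "complex set" ("\<bbbD>")
  where "\<bbbD> \<equiv> {z. cmod z < 1}"

definition sub_disc :: "complex \<Rightarrow> real \<Rightarrow> complex set"
  where "sub_disc a r = {z \<in> \<bbbD>. cmod (z - a) < r}"

text \<open>
  Only the values of \<open>f\<close>, \<open>h\<close>, \<open>g\<close> on the unit disc matter. The pair \<open>(h, g)\<close> is uniquely
  determined on the disc by \<open>f\<close>, because \<open>g\<close> has no constant term.
\<close>

definition harmonic_decomposition ::
    "(complex \<Rightarrow> complex) \<Rightarrow> (complex \<Rightarrow> complex) \<Rightarrow> (complex \<Rightarrow> complex) \<Rightarrow> bool"
  where "harmonic_decomposition f h g \<longleftrightarrow>
    h holomorphic_on \<bbbD> \<and> g holomorphic_on \<bbbD> \<and>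
    (\<exists>a. \<forall>z\<in>\<bbbD>. (\<lambda>n. a (n + 2) * z ^ (n + 2)) sums (h z - z)) \<and>
    (\<exists>b. \<forall>z\<in>\<bbbD>. (\<lambda>n. b (n + 1) * z ^ (n + 1)) sums g z) \<and>
    (\<forall>z\<in>\<bbbD>. f z = h z + cnj (g z))"

definition harmonic_class :: "(complex \<Rightarrow> complex) set" ("\<H>")
  where "\<H> = {f. \<exists>h g. harmonic_decomposition f h g}"

text \<open>The Jacobian of \<open>h + cnj g\<close>, as a function of the pair \<open>(h, g)\<close>.\<close>

definition harmonic_jacobian ::
    "(complex \<Rightarrow> complex) \<Rightarrow> (complex \<Rightarrow> complex) \<Rightarrow> complex \<Rightarrow> real"
  where "harmonic_jacobian h g z = (cmod (deriv h z))\<^sup>2 - (cmod (deriv g z))\<^sup>2"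

definition sense_preserving :: "(complex \<Rightarrow> complex) \<Rightarrow> (complex \<Rightarrow> complex) \<Rightarrow> bool"
  where "sense_preserving h g \<longleftrightarrow> (\<forall>z\<in>\<bbbD>. harmonic_jacobian h g z > 0)"

definition locally_univalent :: "(complex \<Rightarrow> complex) \<Rightarrow> bool"
  where "locally_univalent f \<longleftrightarrow> (\<forall>z\<in>\<bbbD>. \<exists>U. open U \<and> z \<in> U \<and> U \<subseteq> \<bbbD> \<and> inj_on f U)"

definition AK_H :: "(complex \<Rightarrow> complex) set"
  where "AK_H = {f \<in> \<H>. locally_univalent f \<and>
    (\<forall>a\<in>\<bbbD>. \<forall>r\<in>{0<..<1 - cmod a}. convex (f ` sub_disc a r))}"

definition AK_H_tilde :: "(complex \<Rightarrow> complex) set"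
  where "AK_H_tilde = {f \<in> AK_H.
    \<forall>a\<in>\<bbbD>. \<forall>r\<in>{0<..1 - cmod a}. convex (f ` sub_disc a r)}"

text \<open>
  The inequality of the theorem at a point \<open>\<zeta>\<close> and a parameter \<open>b\<close>. Since \<open>x / 0 = 0\<close>, and since
  the fraction with denominator \<open>g'(\<zeta>)\<close> occurs only inside a product with \<open>\<bar>g'(\<zeta>)\<bar>\<^sup>2\<close>, the product is \<open>0\<close>
  wherever \<open>g'(\<zeta>) = 0\<close>, which is the intended reading there.
\<close>

definition absolute_convexity_ineq ::
    "(complex \<Rightarrow> complex) \<Rightarrow> (complex \<Rightarrow> complex) \<Rightarrow> complex \<Rightarrow> complex \<Rightarrow> bool"
  where "absolute_convexity_ineq h g \<zeta> b \<longleftrightarrow>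
    (cmod (deriv h \<zeta>))\<^sup>2 * (1 + (cmod b)\<^sup>2 +
      Re ((\<zeta> - b) * (1 - \<zeta> * cnj b) * deriv (deriv h) \<zeta> / deriv h \<zeta> - 2 * cnj b * \<zeta>))
    \<ge> (cmod (deriv g \<zeta>))\<^sup>2 * (1 + (cmod b)\<^sup>2 +
      Re ((\<zeta> - b) * (1 - \<zeta> * cnj b) * deriv (deriv g) \<zeta> / deriv g \<zeta> - 2 * cnj b * \<zeta>))
      + Re ((\<zeta> - b) ^ 3 * (1 - \<zeta> * cnj b) ^ 3
            / complex_of_real ((cmod (\<zeta> - b))\<^sup>2 * (cmod (1 - \<zeta> * cnj b))\<^sup>2)
          * (deriv (deriv h) \<zeta> * deriv g \<zeta> - deriv h \<zeta> * deriv (deriv g) \<zeta>))"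

end

theory Submission
  imports Defs
begin

text \<open>
  Write \<open>F = h + cnj g\<close> and \<open>J = |h'|\<^sup>2 - |g'|\<^sup>2 > 0\<close>. Every inequality of the theorem is a statement about the
  curvature of the image of one circle: the circles \<open>|(\<zeta> - b) / (1 - \<zeta> cnj b)| = const\<close> are exactly the
  Euclidean circles \<open>|\<zeta> - a| = r\<close> with \<open>|a| + r < 1\<close>, and the difference of the two sides at
  \<open>(\<zeta>, b)\<close> is a positive multiple of \<open>Im (cnj \<gamma>' * \<gamma>'')\<close> at \<open>\<zeta>\<close>, where
  \<open>\<gamma> t = F (a + (\<zeta> - a) cis t)\<close> (\<open>absolute_convexity_ineq_iff\<close>, \<open>euclidean_centre_surj\<close>). So the
  theorem says that all discs have convex images iff the circles in the unit disc are mapped to curves of nonnegative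
  curvature, and only the passage from local to global needs thought.

  Convex images give nonnegative curvature (\<open>curvature_form_nonneg\<close>). Once \<open>F\<close> is known to be injective
  on the closed disc, \<open>F \<zeta>\<close> lies outside the convex image of the open disc, hence on a supporting line,
  and the second derivative test along \<open>\<gamma>\<close> gives the sign. Injectivity is obtained by letting the
  radius grow from \<open>0\<close>: the first failure would be at two boundary points with a common image \<open>w\<close>.
  The image has a supporting line at \<open>w\<close>, and near each of the two points the disc is mapped onto a
  region that contains the initial part of the inner normal at \<open>w\<close>
  (\<open>inner_normal_enters_image\<close>). Hence the two regions overlap, and \<open>F\<close> is not injective in the open
  disc either.

  Conversely, the curvature form is an affine function of the radius up to a positive factor, and it is
  positive for radius zero because \<open>J > 0\<close>. Nonnegativity for all circles in the disc therefore
  implies strict positivity (\<open>curvature_form_pos_of_larger_circle\<close>). Strict positivity means that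
  \<open>|z - a|\<close> has no interior local maximum along a preimage under \<open>F\<close> of a line segment
  (\<open>dist_along_segment_preimage\<close>), so such a preimage with ends in a disc about \<open>a\<close> stays in that
  disc. The radius grows from \<open>0\<close> again: if \<open>F\<close> is injective on a closed disc with convex image \<open>K\<close>,
  then a convex neighbourhood of \<open>K\<close> still has a single-valued preimage, and the segments between
  image points of a slightly larger disc lie in that neighbourhood. Hence the larger disc has a convex
  image too (\<open>convex_image_slightly_larger_cball\<close>). The first failure is excluded by the injectivity
  argument above.

  A disc of radius exactly \<open>1 - |a|\<close> is an increasing union of smaller ones, and an increasing union of
  convex images is convex.
\<close>

section \<open>Continuity in the radius\<close>

text \<open>
  The continuity method, meant for the radius of a disc. The infimum \<open>m\<close> of the failures is not a failure
  by \<open>left\<close>, and then \<open>right\<close> keeps the failures away from \<open>m\<close>.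
\<close>

lemma real_interval_induct:
  fixes G :: "real \<Rightarrow> bool"
  assumes zero: "G 0"
    and right: "\<And>r. \<lbrakk>0 \<le> r; r < T; G r\<rbrakk> \<Longrightarrow> \<exists>e>0. \<forall>s. r < s \<and> s < r + e \<longrightarrow> G s"
    and left: "\<And>r. \<lbrakk>0 < r; r < T; \<And>s. \<lbrakk>0 \<le> s; s < r\<rbrakk> \<Longrightarrow> G s\<rbrakk> \<Longrightarrow> G r"
    and r: "0 \<le> r" "r < T"
  shows "G r"
proof (rule ccontr)
  assume "\<not> G r"
  define B where "B = {s. 0 \<le> s \<and> s < T \<and> \<not> G s}"
  have "r \<in> B" using r \<open>\<not> G r\<close> by (simp add: B_def)
  have bdd: "bdd_below B" by (auto simp: B_def bdd_below_def)
  define m where "m = Inf B"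
  have m: "0 \<le> m" "m \<le> r"
    using \<open>r \<in> B\<close> bdd unfolding m_def by (auto intro!: cInf_greatest cInf_lower simp: B_def)
  have below: "G s" if "0 \<le> s" "s < m" for s
    using that m r cInf_lower[OF _ bdd, of s] unfolding m_def[symmetric] by (fastforce simp: B_def)
  have "G m"
    using zero left[of m] below m r by (cases "m = 0") auto
  then obtain e where e: "e > 0" "\<And>s. \<lbrakk>m < s; s < m + e\<rbrakk> \<Longrightarrow> G s"
    using right[of m] m r by auto
  obtain s where s: "s \<in> B" "s < m + e"
    using cInf_lessD[of B "m + e"] \<open>r \<in> B\<close> e(1) unfolding m_def by auto
  have "m \<le> s" using cInf_lower[OF s(1) bdd] by (simp add: m_def)
  with s \<open>G m\<close> e(2)[of s] show False
    by (cases "m = s") (auto simp: B_def)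
qed

lemma cball_subset_open_imp_ball_subset:
  fixes a :: "'a::euclidean_space"
  assumes "cball a r \<subseteq> U" "open U" "r \<ge> 0"
  obtains R where "r < R" "ball a R \<subseteq> U"
proof -
  obtain e where e: "e > 0" "(\<Union>x\<in>cball a r. ball x e) \<subseteq> U"
    using compact_subset_open_imp_ball_epsilon_subset[OF compact_cball assms(2,1)] by blast
  have "ball a (r + e) \<subseteq> (\<Union>x\<in>cball a r. ball x e)"
  proof
    fix x assume x: "x \<in> ball a (r + e)"
    show "x \<in> (\<Union>x\<in>cball a r. ball x e)"
    proof (cases "dist a x \<le> r")
      case True
      then show ?thesis using e by force
    next
      case False
      define y where "y = a + (r / dist a x) *\<^sub>R (x - a)"
      have d: "dist a x > 0" using False assms(3) by linarith
      have "dist a y = r"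
        using d assms(3) by (simp add: y_def dist_norm norm_minus_commute)
      moreover have "x - y = (1 - r / dist a x) *\<^sub>R (x - a)"
        by (simp add: y_def algebra_simps)
      then have "dist y x = \<bar>1 - r / dist a x\<bar> * dist a x"
        by (simp add: dist_norm norm_minus_commute)
      then have "dist y x = dist a x - r"
        using d False by (simp add: abs_of_nonneg left_diff_distrib)
      ultimately show ?thesis using x by (intro UN_I[of y]) auto
    qed
  qed
  with e that[of "r + e"] show thesis by auto
qed

text \<open>
  The pairs that are either separated by \<open>f\<close> or lie in one common neighbourhood of injectivity form an
  open set. It contains the square of the closed disc, and by compactness the square of a larger disc.
\<close>

lemma inj_on_cball_imp_inj_on_ball:
  fixes f :: "'a::euclidean_space \<Rightarrow> 'b::t2_space"
  assumes inj: "inj_on f (cball a r)" and "r \<ge> 0"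
    and S: "open S" "cball a r \<subseteq> S" "continuous_on S f"
    and loc: "\<And>z. z \<in> S \<Longrightarrow> \<exists>U. open U \<and> z \<in> U \<and> inj_on f U"
  obtains R where "r < R" "ball a R \<subseteq> S" "inj_on f (ball a R)"
proof -
  obtain N where N: "open (N z)" "z \<in> N z" "inj_on f (N z)" if "z \<in> S" for z
    using loc by metis
  define P where "P = {xy \<in> S \<times> S. f (fst xy) \<noteq> f (snd xy)}"
  define P' where "P' = P \<union> (\<Union>z\<in>S. N z \<times> N z)"
  have "open P"
  proof -
    have "continuous_on (S \<times> S) (\<lambda>xy. (f (fst xy), f (snd xy)))"
      by (intro continuous_intros continuous_on_compose2[OF S(3)]) auto
    moreover have "open {xy :: 'b \<times> 'b. fst xy \<noteq> snd xy}"
      by (intro open_Collect_neq continuous_intros)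
    ultimately have "open ((\<lambda>xy. (f (fst xy), f (snd xy))) -` {xy. fst xy \<noteq> snd xy} \<inter> (S \<times> S))"
      using continuous_on_open_vimage[OF open_Times[OF S(1) S(1)]] by blast
    also have "\<dots> = P" by (auto simp: P_def)
    finally show ?thesis .
  qed
  then have "open P'"
    unfolding P'_def using N by (intro open_Un open_UN ballI open_Times) auto
  moreover have "cball a r \<times> cball a r \<subseteq> P'"
  proof clarify
    fix x y assume xy: "x \<in> cball a r" "y \<in> cball a r"
    then have "x \<in> S" "y \<in> S" using S by auto
    show "(x, y) \<in> P'"
    proof (cases "x = y")
      case True
      then show ?thesis using N[OF \<open>x \<in> S\<close>] \<open>x \<in> S\<close> by (auto simp: P'_def)
    next
      case False
      then have "f x \<noteq> f y" using inj xy by (auto dest: inj_onD)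
      then show ?thesis using \<open>x \<in> S\<close> \<open>y \<in> S\<close> by (auto simp: P'_def P_def)
    qed
  qed
  ultimately obtain e where e: "e > 0"
      "(\<Union>x\<in>cball a r \<times> cball a r. ball x e) \<subseteq> P'"
    using compact_subset_open_imp_ball_epsilon_subset[of "cball a r \<times> cball a r" P']
    by (metis compact_Times compact_cball)
  have nbhd: "open (\<Union>x\<in>cball a r. ball x (e / 2))"
    "cball a r \<subseteq> (\<Union>x\<in>cball a r. ball x (e / 2))"
    using e by auto
  obtain R1 where R1: "r < R1" "ball a R1 \<subseteq> (\<Union>x\<in>cball a r. ball x (e / 2))"
    by (rule cball_subset_open_imp_ball_subset[OF nbhd(2,1) assms(2)])
  obtain R2 where R2: "r < R2" "ball a R2 \<subseteq> S"
    by (rule cball_subset_open_imp_ball_subset[OF S(2,1) assms(2)])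
  define R where "R = min R1 R2"
  have "inj_on f (ball a R)"
  proof (rule inj_onI)
    fix x y assume xy: "x \<in> ball a R" "y \<in> ball a R" "f x = f y"
    have "ball a R \<subseteq> (\<Union>x\<in>cball a r. ball x (e / 2))"
      using R1 subset_ball[of R R1 a] by (auto simp: R_def)
    with xy have "x \<in> (\<Union>x\<in>cball a r. ball x (e / 2))" "y \<in> (\<Union>x\<in>cball a r. ball x (e / 2))"
      by blast+
    then obtain x' y' where x': "x' \<in> cball a r" "dist x' x < e / 2"
        and y': "y' \<in> cball a r" "dist y' y < e / 2"
      by auto
    have "dist (x', y') (x, y) \<le> dist x' x + dist y' y"
      by (simp add: dist_Pair_Pair sqrt_sum_squares_le_sum)
    then have "(x, y) \<in> ball (x', y') e" using x' y' by simp
    then have "(x, y) \<in> P'" using e(2) x' y' by blast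
    then obtain z where "z \<in> S" "x \<in> N z" "y \<in> N z"
      using xy by (auto simp: P'_def P_def)
    then show "x = y" using N(3)[of z] xy(3) by (auto dest: inj_onD)
  qed
  moreover have "r < R" "ball a R \<subseteq> S"
    using R1 R2 subset_ball[of R R2 a] by (auto simp: R_def)
  ultimately show thesis using that by blast
qed

lemma second_derivative_nonpos_at_local_max:
  fixes \<phi> \<phi>' :: "real \<Rightarrow> real"
  assumes der: "\<And>t. \<bar>t - c\<bar> < \<delta> \<Longrightarrow> (\<phi> has_real_derivative \<phi>' t) (at t)" and "\<delta> > 0"
    and der2: "(\<phi>' has_real_derivative D) (at c)"
    and max: "\<And>t. \<bar>t - c\<bar> < \<delta> \<Longrightarrow> \<phi> t \<le> \<phi> c"
  shows "\<phi>' c = 0" "D \<le> 0"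
proof -
  show 0: "\<phi>' c = 0"
    using DERIV_local_max[OF der[of c] \<open>\<delta> > 0\<close>] max \<open>\<delta> > 0\<close> by (simp add: abs_minus_commute)
  show "D \<le> 0"
  proof (rule ccontr)
    assume "\<not> D \<le> 0"
    then obtain d where d: "d > 0" "\<And>h. \<lbrakk>h > 0; h < d\<rbrakk> \<Longrightarrow> \<phi>' c < \<phi>' (c + h)"
      using DERIV_pos_inc_right[OF der2] by auto
    define h where "h = min (d / 2) (\<delta> / 2)"
    have h: "h > 0" "h < d" "h < \<delta>" using d(1) \<open>\<delta> > 0\<close> by (auto simp: h_def)
    have "\<exists>t>c. t < c + h \<and> \<phi> (c + h) - \<phi> c = (c + h - c) * \<phi>' t"
      using h by (intro MVT2) (auto intro!: der)
    then obtain t where t: "c < t" "t < c + h" "\<phi> (c + h) - \<phi> c = h * \<phi>' t" by auto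
    have "\<phi>' t > 0" using d(2)[of "t - c"] t h 0 by auto
    then have "\<phi> (c + h) > \<phi> c" using t h by (metis diff_gt_0_iff_gt mult_pos_pos)
    with max[of "c + h"] h show False by auto
  qed
qed

text \<open>
  Two points of the open disc lie in a common smaller closed disc, so the image is an increasing union
  of convex sets.
\<close>

lemma convex_image_ball_of_cballs:
  assumes "\<And>s. \<lbrakk>0 \<le> s; s < r\<rbrakk> \<Longrightarrow> convex (f ` cball a s)"
  shows "convex (f ` ball a r)"
proof (rule convexI)
  fix x y and u v :: real
  assume "x \<in> f ` ball a r" "y \<in> f ` ball a r" and uv: "0 \<le> u" "0 \<le> v" "u + v = 1"
  then obtain p q where pq: "p \<in> ball a r" "q \<in> ball a r" "x = f p" "y = f q" by blast
  define s where "s = max (dist a p) (dist a q)"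
  have "convex (f ` cball a s)" using pq by (intro assms) (simp_all add: s_def le_max_iff_disj)
  moreover have "x \<in> f ` cball a s" "y \<in> f ` cball a s"
    using pq by (auto simp: s_def)
  ultimately have "u *\<^sub>R x + v *\<^sub>R y \<in> f ` cball a s" using uv by (rule convexD)
  moreover have "cball a s \<subseteq> ball a r" using pq by (auto simp: s_def)
  ultimately show "u *\<^sub>R x + v *\<^sub>R y \<in> f ` ball a r" by blast
qed

lemma inj_on_ball_of_cballs:
  assumes "\<And>s. \<lbrakk>0 \<le> s; s < r\<rbrakk> \<Longrightarrow> inj_on f (cball a s)"
  shows "inj_on f (ball a r)"
proof (rule inj_onI)
  fix x y assume xy: "x \<in> ball a r" "y \<in> ball a r" "f x = f y"
  have "inj_on f (cball a (max (dist a x) (dist a y)))"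
    using xy by (intro assms) (simp_all add: le_max_iff_disj)
  then show "x = y" using xy(3) by (rule inj_onD) auto
qed

section \<open>Sense-preserving harmonic maps as local diffeomorphisms\<close>

locale sense_preserving_on =
  fixes h g :: "complex \<Rightarrow> complex" and S :: "complex set"
  assumes open_S: "open S" and hol: "h holomorphic_on S" "g holomorphic_on S"
    and jacobian_pos: "z \<in> S \<Longrightarrow> harmonic_jacobian h g z > 0"
begin

definition F :: "complex \<Rightarrow> complex" where "F z = h z + cnj (g z)"

text \<open>
  The differential of \<open>F\<close> as a real-linear map, and its inverse (\<open>dF_inv\<close> below) in closed form. The
  explicit inverse makes the preimages of line segments accessible to differentiation.
\<close>

definition dF :: "complex \<Rightarrow> complex \<Rightarrow> complex"
  where "dF z d = deriv h z * d + cnj (deriv g z * d)"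

definition dF_inv :: "complex \<Rightarrow> complex \<Rightarrow> complex"
  where "dF_inv z e =
    (cnj (deriv h z) * e - cnj (deriv g z) * cnj e) / of_real (harmonic_jacobian h g z)"

lemma has_derivs:
  assumes "z \<in> S"
  shows "(h has_field_derivative deriv h z) (at z)" "(g has_field_derivative deriv g z) (at z)"
  using assms hol open_S by (auto intro: holomorphic_derivI)

lemma has_second_derivs:
  assumes "z \<in> S"
  shows "(deriv h has_field_derivative deriv (deriv h) z) (at z)"
    "(deriv g has_field_derivative deriv (deriv g) z) (at z)"
  using assms hol open_S by (auto intro!: holomorphic_derivI[OF _ open_S] holomorphic_deriv)

lemma jacobian_complex:
  "of_real (harmonic_jacobian h g z) = deriv h z * cnj (deriv h z) - deriv g z * cnj (deriv g z)"
  unfolding harmonic_jacobian_def of_real_diff complex_norm_square ..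

lemma dF_dF_inv: "z \<in> S \<Longrightarrow> dF z (dF_inv z e) = e"
proof -
  assume "z \<in> S"
  then have J: "complex_of_real (harmonic_jacobian h g z) \<noteq> 0"
    using jacobian_pos[of z] by simp
  have "dF z (dF_inv z e) * of_real (harmonic_jacobian h g z)
      = deriv h z * (cnj (deriv h z) * e - cnj (deriv g z) * cnj e)
        + cnj (deriv g z * (cnj (deriv h z) * e - cnj (deriv g z) * cnj e))"
    using J by (simp add: dF_def dF_inv_def field_simps)
  also have "\<dots> = e * of_real (harmonic_jacobian h g z)"
    unfolding jacobian_complex by (simp add: algebra_simps)
  finally show ?thesis using J by simp
qed

lemma dF_inv_dF: "z \<in> S \<Longrightarrow> dF_inv z (dF z d) = d"
proof -
  assume "z \<in> S"
  then have J: "complex_of_real (harmonic_jacobian h g z) \<noteq> 0"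
    using jacobian_pos[of z] by simp
  have "cnj (deriv h z) * dF z d - cnj (deriv g z) * cnj (dF z d)
      = d * of_real (harmonic_jacobian h g z)"
    unfolding jacobian_complex dF_def by (simp add: algebra_simps)
  then show ?thesis using J by (simp add: dF_inv_def)
qed

lemma dF_inv_scaleR: "dF_inv z (t *\<^sub>R e) = t *\<^sub>R dF_inv z e"
  by (simp add: dF_inv_def scaleR_conv_of_real algebra_simps diff_divide_distrib)

lemma bounded_linear_dF: "bounded_linear (dF z)"
  unfolding dF_def
  by (intro bounded_linear_add bounded_linear_mult_right
      bounded_linear_compose[OF bounded_linear_cnj bounded_linear_mult_right])

lemma F_has_derivative: "z \<in> S \<Longrightarrow> (F has_derivative dF z) (at z)"
  unfolding F_def[abs_def] dF_def[abs_def]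
  using has_derivs[of z] unfolding has_field_derivative_def
  by (intro has_derivative_add has_derivative_cnj) auto

lemma continuous_F: "continuous_on S F"
  using F_has_derivative has_derivative_continuous continuous_at_imp_continuous_on by blast

lemma local_inverse:
  assumes "z \<in> S"
  obtains U V k where "open U" "U \<subseteq> S" "z \<in> U" "open V" "F z \<in> V" "homeomorphism U V F k"
    "\<forall>y\<in>V. (k has_derivative dF_inv (k y)) (at y)"
proof -
  define f' where "f' z = blinfun_mult_right (deriv h z)
      + (Blinfun cnj o\<^sub>L blinfun_mult_right (deriv g z))" for z
  have f': "blinfun_apply (f' z) = dF z" for z
    by (rule ext) (simp add: f'_def dF_def plus_blinfun.rep_eq bounded_linear_Blinfun_apply bounded_linear_cnj)
  have bl: "bounded_linear (dF_inv z)"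
    unfolding dF_inv_def divide_inverse
    by (intro bounded_linear_intros bounded_linear_sub bounded_linear_compose[OF bounded_linear_mult_right bounded_linear_cnj])
  have "continuous_on S (deriv h)" "continuous_on S (deriv g)"
    using hol open_S holomorphic_deriv holomorphic_on_imp_continuous_on by blast+
  then have cont: "continuous_on S f'"
    unfolding f'_def by (intro continuous_intros)
  have inv: "Blinfun (dF_inv z) o\<^sub>L f' z = id_blinfun"
    by (rule blinfun_eqI) (simp add: bounded_linear_Blinfun_apply[OF bl] f' dF_inv_dF assms)
  have der: "(F has_derivative blinfun_apply (f' x)) (at x)" if "x \<in> S" for x
    using F_has_derivative[OF that] by (simp add: f')
  show thesis
  proof (rule inverse_function_theorem[OF open_S der cont assms inv])
    fix U V k k'
    assume UV: "open U" "U \<subseteq> S" "z \<in> U" "open V" "F z \<in> V" "homeomorphism U V F k"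
      and k: "\<And>y. y \<in> V \<Longrightarrow> (k has_derivative k' y) (at y)"
        "\<And>y. y \<in> V \<Longrightarrow> k' y = inv (blinfun_apply (f' (k y)))"
    have k': "k' y = dF_inv (k y)" if "y \<in> V" for y
    proof -
      have "k y \<in> S" using UV that unfolding homeomorphism_def by blast
      then have "inv (dF (k y)) = dF_inv (k y)"
        by (intro inv_unique_comp) (auto simp: fun_eq_iff dF_dF_inv dF_inv_dF)
      then show ?thesis using k(2)[OF that] by (simp add: f')
    qed
    show thesis
      using UV k(1) k' by (intro that[of U V k]) auto
  qed
qed

lemma locally_injective: "z \<in> S \<Longrightarrow> \<exists>U. open U \<and> z \<in> U \<and> U \<subseteq> S \<and> inj_on F U"
proof -
  assume "z \<in> S"
  then obtain U V k where UV: "open U" "U \<subseteq> S" "z \<in> U" "homeomorphism U V F k"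
    by (rule local_inverse)
  then have "inj_on F U"
    by (intro inj_on_inverseI[of U k]) (simp add: homeomorphism_apply1)
  with UV show ?thesis by blast
qed

lemma open_image:
  assumes "open U" "U \<subseteq> S"
  shows "open (F ` U)"
proof (subst open_subopen, clarify)
  fix z assume z: "z \<in> U"
  then obtain N where N: "open N" "z \<in> N" "N \<subseteq> S" "inj_on F N"
    using locally_injective[of z] assms by auto
  have "open (F ` (N \<inter> U))"
    using N assms by (intro invariance_of_domain) (auto intro: continuous_on_subset[OF continuous_F] inj_on_subset)
  then show "\<exists>T. open T \<and> F z \<in> T \<and> T \<subseteq> F ` U"
    using z N by blast
qed

lemma F_line_derivative:
  assumes "p \<in> S"
  shows "((\<lambda>t. F (p + t *\<^sub>R d)) has_vector_derivative dF p d) (at 0)"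
proof -
  have line: "((\<lambda>t. p + t *\<^sub>R d) has_derivative (\<lambda>t. t *\<^sub>R d)) (at 0)"
    by (auto intro!: derivative_eq_intros)
  have "(F has_derivative dF p) (at (p + 0 *\<^sub>R d))"
    using F_has_derivative[OF assms] by simp
  from has_derivative_compose[OF line this] show ?thesis
    unfolding has_vector_derivative_def
    by (simp add: linear_cmul[OF bounded_linear.linear[OF bounded_linear_dF]])
qed

lemma has_derivative_inv_into_F:
  assumes U: "open U" "U \<subseteq> S" "inj_on F U" and w: "w \<in> F ` U"
  shows "(inv_into U F has_derivative dF_inv (inv_into U F w)) (at w)"
proof -
  let ?k = "inv_into U F"
  have k: "?k w \<in> U" "F (?k w) = w" using w by (auto intro: inv_into_into f_inv_into_f)
  then have S: "?k w \<in> S" using U by auto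
  have "(?k has_derivative dF_inv (?k w)) (at (F (?k w)))"
  proof (rule has_derivative_inverse_strong[OF U(1) k(1)])
    show "continuous_on U F" using continuous_F U(2) by (rule continuous_on_subset)
    show "?k (F x) = x" if "x \<in> U" for x using U(3) that by (rule inv_into_f_f)
    show "(F has_derivative dF (?k w)) (at (?k w))" using S by (rule F_has_derivative)
    show "dF (?k w) \<circ> dF_inv (?k w) = id" using S by (auto simp: fun_eq_iff dF_dF_inv)
  qed
  then show ?thesis by (simp add: k)
qed

end

section \<open>Convex images of discs force injectivity\<close>

text \<open>
  The squared distance to the centre has derivative \<open>2 * inner (c 0 - a) d < 0\<close>.
\<close>

lemma eventually_in_ball_of_inward_derivative:
  fixes c :: "real \<Rightarrow> complex"
  assumes der: "(c has_vector_derivative d) (at 0)" and c0: "cmod (c 0 - a) = r"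
    and inward: "inner (c 0 - a) d < 0"
  shows "\<forall>\<^sub>F t in at_right 0. c t \<in> ball a r"
proof -
  have "((\<lambda>t. inner (c t - a) (c t - a)) has_real_derivative 2 * inner (c 0 - a) d) (at 0)"
    unfolding has_real_derivative_iff_has_vector_derivative has_vector_derivative_def
    by (rule derivative_eq_intros der[unfolded has_vector_derivative_def] refl)+
      (auto simp: inner_commute algebra_simps)
  from DERIV_neg_dec_right[OF this] inward obtain e where e: "e > 0"
      "\<And>t. \<lbrakk>t > 0; t < e\<rbrakk> \<Longrightarrow> inner (c t - a) (c t - a) < inner (c 0 - a) (c 0 - a)"
    by auto
  have "c t \<in> ball a r" if "t > 0" "t < e" for t
  proof -
    have "(cmod (c t - a))\<^sup>2 < (cmod (c 0 - a))\<^sup>2"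
      using e(2)[OF that] by (simp add: power2_norm_eq_inner)
    then have "cmod (c t - a) < cmod (c 0 - a)" by (rule power2_less_imp_less) simp
    then show ?thesis using c0 by (simp add: dist_norm norm_minus_commute)
  qed
  then show ?thesis unfolding eventually_at_right_field using e(1) by auto
qed

context sense_preserving_on
begin

text \<open>
  The image near a boundary point \<open>p\<close> fills all of the supporting half plane except for a sliver along
  the supporting line. Only its consequence for the normal direction matters here: pulled back by the
  differential, the inner normal \<open>n\<close> points into the disc. Indeed the half plane of inward directions
  at \<open>p\<close> is mapped into the half plane of \<open>n\<close>, and a linear isomorphism that does so cannot map a
  direction outside it to \<open>n\<close>.
\<close>

lemma inner_normal_enters_image:
  assumes ball: "ball a r \<subseteq> S" and p: "p \<in> S" "cmod (p - a) = r" and "r > 0" and "n \<noteq> 0"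
    and support: "\<And>z. z \<in> ball a r \<Longrightarrow> 0 \<le> inner n (F z - F p)"
    and N: "open N" "p \<in> N"
  shows "\<forall>\<^sub>F e in at_right 0. F p + e *\<^sub>R n \<in> F ` (ball a r \<inter> N)"
proof -
  have inward: "0 \<le> inner n (dF p x)" if "inner (p - a) x < 0" for x
  proof (rule ccontr)
    assume "\<not> 0 \<le> inner n (dF p x)"
    moreover have "((\<lambda>t. inner n (F (p + t *\<^sub>R x))) has_real_derivative inner n (dF p x)) (at 0)"
      unfolding has_real_derivative_iff_has_vector_derivative
      by (rule bounded_linear.has_vector_derivative[OF bounded_linear_inner_right F_line_derivative[OF p(1)]])
    ultimately have "\<exists>e>0. \<forall>t>0. t < e \<longrightarrow>
        inner n (F (p + (0 + t) *\<^sub>R x)) < inner n (F (p + 0 *\<^sub>R x))"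
      by (intro DERIV_neg_dec_right) auto
    then obtain e where e: "e > 0"
        "\<And>t. \<lbrakk>t > 0; t < e\<rbrakk> \<Longrightarrow> inner n (F (p + t *\<^sub>R x)) < inner n (F p)"
      by auto
    have "((\<lambda>t. p + t *\<^sub>R x) has_vector_derivative x) (at 0)"
      by (auto intro!: derivative_eq_intros)
    then have "\<forall>\<^sub>F t in at_right 0. p + t *\<^sub>R x \<in> ball a r"
      using p that by (intro eventually_in_ball_of_inward_derivative) auto
    moreover have "\<forall>\<^sub>F t in at_right 0. 0 < t \<and> t < e"
      using e(1) by (auto simp: eventually_at_right_field)
    ultimately have "\<forall>\<^sub>F t in at_right (0::real). False"
    proof eventually_elim
      case (elim t)
      then show ?case using support[of "p + t *\<^sub>R x"] e(2)[of t] by (simp add: inner_diff_right)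
    qed
    then show False by simp
  qed
  define d where "d = dF_inv p n"
  have d: "dF p d = n" using p(1) by (simp add: d_def dF_dF_inv)
  have "inner (p - a) d < 0"
  proof (rule ccontr)
    assume *: "\<not> inner (p - a) d < 0"
    define C where "C = inner n (dF p (p - a))"
    \<comment> \<open>The vector \<open>- d\<close> is inward or tangential. Tilting it inwards by a small \<open>e\<close> makes it strictly
      inward, while its image stays close to \<open>- n\<close>, on the wrong side of the supporting line.\<close>
    define e where "e = inner n n / (\<bar>C\<bar> + 1)"
    have "e > 0" using \<open>n \<noteq> 0\<close> by (simp add: e_def add_nonneg_pos)
    have "inner (p - a) (p - a) > 0" using p(2) \<open>r > 0\<close> by auto
    then have "e * inner (p - a) (p - a) > 0" using \<open>e > 0\<close> by (rule mult_pos_pos[rotated])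
    moreover have "inner v (- d - e *\<^sub>R v) = - inner v d - e * inner v v" for v
      by (simp add: inner_diff_right)
    ultimately have "inner (p - a) (- d - e *\<^sub>R (p - a)) < 0"
      using * by simp
    then have "0 \<le> inner n (dF p (- d - e *\<^sub>R (p - a)))" by (rule inward)
    also have "dF p (- d - e *\<^sub>R (p - a)) = - n - e *\<^sub>R dF p (p - a)"
      using bounded_linear.linear[OF bounded_linear_dF, of p] d
      by (simp add: linear_diff linear_neg linear_cmul)
    finally have "inner n n \<le> - e * C" by (simp add: inner_diff_right C_def)
    also have "\<dots> \<le> e * \<bar>C\<bar>" using \<open>e > 0\<close> mult_left_mono[of "- C" "\<bar>C\<bar>" e] by simp
    also have "\<dots> < e * (\<bar>C\<bar> + 1)" using \<open>e > 0\<close> by simp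
    also have "\<dots> = inner n n" by (simp add: e_def)
    finally show False by simp
  qed
  obtain U V k where UV: "open U" "U \<subseteq> S" "p \<in> U" "open V" "F p \<in> V" "homeomorphism U V F k"
    and k: "\<forall>y\<in>V. (k has_derivative dF_inv (k y)) (at y)"
    by (rule local_inverse[OF p(1)])
  define q where "q e = k (F p + e *\<^sub>R n)" for e
  have q0: "q 0 = p" using homeomorphism_apply1[OF UV(6,3)] by (simp add: q_def)
  have "(k has_derivative dF_inv p) (at (F p))"
    using bspec[OF k UV(5)] q0 by (simp add: q_def)
  then have k_der: "(k has_derivative dF_inv p) (at (F p + 0 *\<^sub>R n))" by simp
  have line: "((\<lambda>e. F p + e *\<^sub>R n) has_derivative (\<lambda>e. e *\<^sub>R n)) (at 0)"
    by (auto intro!: derivative_eq_intros)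
  have "(q has_derivative (\<lambda>e. dF_inv p (e *\<^sub>R n))) (at 0)"
    using has_derivative_compose[OF line k_der] by (simp add: q_def[abs_def])
  moreover have "dF_inv p (e *\<^sub>R n) = e *\<^sub>R d" for e
    by (simp add: d_def dF_inv_def scaleR_conv_of_real algebra_simps diff_divide_distrib)
  ultimately have q: "(q has_vector_derivative d) (at 0)"
    by (simp add: has_vector_derivative_def)
  have "\<forall>\<^sub>F e in at_right 0. q e \<in> ball a r"
    using q0 p \<open>inner (p - a) d < 0\<close> by (intro eventually_in_ball_of_inward_derivative[OF q]) auto
  moreover have "\<forall>\<^sub>F e in at_right 0. q e \<in> N"
  proof -
    have "isCont q 0" by (rule has_derivative_continuous[OF q[unfolded has_vector_derivative_def]])
    then have "(q \<longlongrightarrow> p) (at_right 0)" using q0 by (simp add: isCont_def filterlim_at_split)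
    then show ?thesis by (rule topological_tendstoD[OF _ N])
  qed
  moreover have "\<forall>\<^sub>F e in at_right 0. F p + e *\<^sub>R n \<in> V"
  proof -
    have "((\<lambda>e. F p + e *\<^sub>R n) \<longlongrightarrow> F p + 0 *\<^sub>R n) (at_right 0)"
      by (intro tendsto_intros)
    then show ?thesis by (rule topological_tendstoD[OF _ UV(4)]) (simp add: UV(5))
  qed
  ultimately show ?thesis
  proof eventually_elim
    case (elim e)
    then have "F (q e) = F p + e *\<^sub>R n" using homeomorphism_apply2[OF UV(6)] by (simp add: q_def)
    then show ?case using elim by (intro image_eqI[of _ _ "q e"]) auto
  qed
qed

lemma supporting_normal:
  assumes "convex (F ` ball a r)" "w \<notin> F ` ball a r"
  obtains n where "n \<noteq> 0" "\<And>z. z \<in> ball a r \<Longrightarrow> 0 \<le> inner n (F z - w)"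
proof -
  have "convex ((\<lambda>x. x - w) ` F ` ball a r)" "0 \<notin> (\<lambda>x. x - w) ` F ` ball a r"
    using assms by (auto simp: convex_translation_subtract)
  from separating_hyperplane_set_0[OF this] that show thesis by auto
qed

text \<open>
  Suppose that \<open>p\<close> and \<open>q\<close> have the same image. If it lies in the open image, continuity produces distinct points
  of the open disc with equal images. Otherwise both points are on the circle, and the images of the
  disc near \<open>p\<close> and near \<open>q\<close> both contain the beginning of the same inner normal.
\<close>

lemma inj_on_cball_of_convex_image:
  assumes S: "cball a r \<subseteq> S" and "r > 0" and inj: "inj_on F (ball a r)"
    and conv: "convex (F ` ball a r)"
  shows "inj_on F (cball a r)"
proof (rule ccontr)
  assume "\<not> inj_on F (cball a r)"
  then obtain p q where pq: "p \<in> cball a r" "q \<in> cball a r" "F p = F q" "p \<noteq> q"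
    by (auto simp: inj_on_def)
  have ballS: "ball a r \<subseteq> S" using S by auto
  have cl: "x \<in> closure (ball a r)" if "x \<in> cball a r" for x
    using that \<open>r > 0\<close> by simp
  have out: "F p \<notin> F ` ball a r"
  proof
    assume "F p \<in> F ` ball a r"
    then obtain z where z: "z \<in> ball a r" "F z = F p" by auto
    obtain y where y: "y \<in> cball a r" "F y = F z" "y \<noteq> z" using pq z by metis
    obtain A B where AB: "open A" "open B" "y \<in> A" "z \<in> B" "A \<inter> B = {}"
      using hausdorff[OF y(3)] by blast
    have oU: "open (F ` (B \<inter> ball a r))"
      using AB ballS by (intro open_image) auto
    have "F y \<in> F ` (B \<inter> ball a r)" using z(1) y(2) AB(4) by blast
    moreover have "continuous (at y) F"
      using y(1) S has_derivative_continuous[OF F_has_derivative] by blast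
    ultimately have "\<exists>M. open M \<and> y \<in> M \<and> (\<forall>x\<in>M. F x \<in> F ` (B \<inter> ball a r))"
      using oU unfolding continuous_at_open by simp
    then obtain M where M: "open M" "y \<in> M" "\<And>x. x \<in> M \<Longrightarrow> F x \<in> F ` (B \<inter> ball a r)"
      by blast
    have "(A \<inter> M) \<inter> ball a r \<noteq> {}"
      using cl[OF y(1)] AB M open_Int_closure_eq_empty[OF open_Int[OF AB(1) M(1)], of "ball a r"]
      by blast
    then obtain x where x: "x \<in> A" "x \<in> M" "x \<in> ball a r" by auto
    then obtain x' where "x' \<in> B" "x' \<in> ball a r" "F x = F x'" using M(3) by blast
    then show False using inj_onD[OF inj, of x x'] x AB by blast
  qed
  obtain n where n: "n \<noteq> 0" "\<And>z. z \<in> ball a r \<Longrightarrow> 0 \<le> inner n (F z - F p)"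
    using supporting_normal[OF conv out] by blast
  have bd: "cmod (x - a) = r" if "x \<in> cball a r" "F x = F p" for x
    using that out by (metis dist_norm image_eqI less_eq_real_def mem_ball mem_cball norm_minus_commute)
  obtain A B where AB: "open A" "open B" "p \<in> A" "q \<in> B" "A \<inter> B = {}"
    using hausdorff[OF pq(4)] by blast
  have "\<forall>\<^sub>F e in at_right 0. F p + e *\<^sub>R n \<in> F ` (ball a r \<inter> A)"
    using pq S AB n by (intro inner_normal_enters_image ballS bd \<open>r > 0\<close>) auto
  moreover have "\<forall>\<^sub>F e in at_right 0. F q + e *\<^sub>R n \<in> F ` (ball a r \<inter> B)"
    using pq S AB n by (intro inner_normal_enters_image ballS bd \<open>r > 0\<close>) auto
  ultimately have "\<forall>\<^sub>F e in at_right (0::real). False"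
  proof eventually_elim
    case (elim e)
    obtain x where x: "F p + e *\<^sub>R n = F x" "x \<in> ball a r" "x \<in> A" using elim(1) by blast
    obtain y where y: "F q + e *\<^sub>R n = F y" "y \<in> ball a r" "y \<in> B" using elim(2) by blast
    have "F x = F y" using x(1) y(1) pq(3) by metis
    then have "x = y" using x(2) y(2) by (rule inj_onD[OF inj])
    then show False using x(3) y(3) AB(5) by blast
  qed
  then show False by simp
qed

lemma inj_on_larger_ball:
  assumes "inj_on F (cball a r)" "r \<ge> 0" "cball a r \<subseteq> S"
  obtains R where "r < R" "ball a R \<subseteq> S" "inj_on F (ball a R)"
proof (rule inj_on_cball_imp_inj_on_ball[OF assms(1,2) open_S assms(3) continuous_F])
  show "\<exists>U. open U \<and> z \<in> U \<and> inj_on F U" if "z \<in> S" for z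
    using locally_injective[OF that] by blast
qed

lemma inj_on_cball_of_convex_images:
  assumes S: "ball a T \<subseteq> S" and conv: "\<And>r. \<lbrakk>0 < r; r < T\<rbrakk> \<Longrightarrow> convex (F ` ball a r)"
    and r: "0 \<le> r" "r < T"
  shows "inj_on F (cball a r)"
proof -
  have sub: "cball a s \<subseteq> S" if "s < T" for s using that S by force
  show ?thesis
  proof (rule real_interval_induct[where G = "\<lambda>r. inj_on F (cball a r)" and T = T])
    show "inj_on F (cball a 0)" by simp
  next
    fix s assume s: "0 \<le> s" "s < T" "inj_on F (cball a s)"
    obtain R where "s < R" "ball a R \<subseteq> S" "inj_on F (ball a R)"
      by (rule inj_on_larger_ball[OF s(3,1) sub[OF s(2)]])
    then show "\<exists>e>0. \<forall>s'. s < s' \<and> s' < s + e \<longrightarrow> inj_on F (cball a s')"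
      by (intro exI[of _ "R - s"]) (auto intro: inj_on_subset)
  next
    fix s assume s: "0 < s" "s < T" and less: "\<And>s'. \<lbrakk>0 \<le> s'; s' < s\<rbrakk> \<Longrightarrow> inj_on F (cball a s')"
    have "inj_on F (ball a s)" using less by (rule inj_on_ball_of_cballs)
    then show "inj_on F (cball a s)"
      using s sub conv by (intro inj_on_cball_of_convex_image) auto
  qed (use r in auto)
qed

end

section \<open>The curvature of images of circles\<close>

text \<open>
  This is \<open>Im (cnj \<gamma>' * \<gamma>'')\<close> at \<open>t = 0\<close> for \<open>\<gamma> t = F (z - u + u * cis t)\<close>, that is, the curvature of
  the image of the circle with centre \<open>z - u\<close> through \<open>z\<close>, times \<open>|\<gamma>'|\<^sup>3\<close>. It is written with products
  only, so that zeros of the derivative of \<open>g\<close> need no special treatment.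
\<close>

definition curvature_form ::
    "(complex \<Rightarrow> complex) \<Rightarrow> (complex \<Rightarrow> complex) \<Rightarrow> complex \<Rightarrow> complex \<Rightarrow> real"
  where "curvature_form h g z u =
    (cmod u)\<^sup>2 * (harmonic_jacobian h g z
      + Re (u * (deriv (deriv h) z * cnj (deriv h z) - deriv (deriv g) z * cnj (deriv g z))))
    - Re (u ^ 3 * (deriv (deriv h) z * deriv g z - deriv h z * deriv (deriv g) z))"

text \<open>
  Scaling \<open>u\<close> by \<open>s\<close> replaces the circle by another one with the same tangent at \<open>z\<close>. Up to the factor
  \<open>s\<^sup>2\<close>, the form is affine in \<open>s\<close>.
\<close>

lemma curvature_form_scale:
  "curvature_form h g z (of_real s * u) = s\<^sup>2 * ((cmod u)\<^sup>2 * harmonic_jacobian h g z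
    + s * (curvature_form h g z u - (cmod u)\<^sup>2 * harmonic_jacobian h g z))"
proof -
  have R: "Re (of_real x * y) = x * Re y" for x y by simp
  have "(of_real s * u) ^ 3 * D = of_real (s ^ 3) * (u ^ 3 * D)" for D
    by (simp add: power_mult_distrib)
  then have "Re ((of_real s * u) ^ 3 * D) = s ^ 3 * Re (u ^ 3 * D)" for D
    by (simp only: R)
  moreover have "Re (of_real s * u * D) = s * Re (u * D)" for D
    by (simp only: R mult.assoc)
  moreover have "(cmod (of_real s * u))\<^sup>2 = s\<^sup>2 * (cmod u)\<^sup>2"
    by (simp add: norm_mult power_mult_distrib)
  ultimately show ?thesis
    by (simp only: curvature_form_def) (simp add: algebra_simps power2_eq_square power3_eq_cube)
qed

text \<open>
  The affine function of \<open>curvature_form_scale\<close> is positive at \<open>0\<close>, so that nonnegativity at some \<open>s > 1\<close>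
  gives positivity at \<open>1\<close>.
\<close>

lemma curvature_form_pos_of_larger_circle:
  assumes "z \<noteq> a" and "harmonic_jacobian h g z > 0" and "s > 1"
    and "0 \<le> curvature_form h g z (of_real s * (z - a))"
  shows "0 < curvature_form h g z (z - a)"
proof -
  define J where "J = (cmod (z - a))\<^sup>2 * harmonic_jacobian h g z"
  define C where "C = curvature_form h g z (z - a)"
  have "J > 0" using assms by (simp add: J_def)
  have "0 \<le> s\<^sup>2 * (J + s * (C - J))"
    using assms(4) unfolding curvature_form_scale J_def C_def .
  then have "0 \<le> J + s * (C - J)" using \<open>s > 1\<close> by (simp add: zero_le_mult_iff)
  then have "s * C \<ge> (s - 1) * J" by (simp add: algebra_simps)
  moreover have "(s - 1) * J > 0" using \<open>J > 0\<close> \<open>s > 1\<close> by simp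
  ultimately have "s * C > 0" by linarith
  then show ?thesis using \<open>s > 1\<close> by (simp add: C_def zero_less_mult_iff)
qed

context sense_preserving_on
begin

text \<open>
  For \<open>u = z - a\<close> this is an outer normal, at \<open>F z\<close>, of the image of the circle about \<open>a\<close> through \<open>z\<close>:
  the tangent \<open>dF z (\<i> * u)\<close> is \<open>\<i>\<close> times it, see \<open>dF_i\<close>.
\<close>

definition conormal :: "complex \<Rightarrow> complex \<Rightarrow> complex"
  where "conormal z u = deriv h z * u - cnj (deriv g z * u)"

text \<open>
  The adjoint of the inverse differential maps \<open>u\<close> to \<open>conormal z u / J\<close>: the gradient of the distance
  to \<open>a\<close>, transported to the image, is normal to the image circle.
\<close>

lemma inner_dF_inv:
  assumes "z \<in> S"
  shows "inner u (dF_inv z e) = inner (conormal z u) e / harmonic_jacobian h g z"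
proof -
  have "inner u (dF_inv z e)
      = inner u (cnj (deriv h z) * e - cnj (deriv g z) * cnj e) / harmonic_jacobian h g z"
    unfolding dF_inv_def by (simp add: inner_complex_def add_divide_distrib)
  also have "inner u (cnj (deriv h z) * e - cnj (deriv g z) * cnj e) = inner (conormal z u) e"
    by (simp add: inner_complex_def conormal_def algebra_simps)
  finally show ?thesis .
qed

lemma dF_i: "dF z (\<i> * u) = \<i> * conormal z u"
  by (simp add: dF_def conormal_def algebra_simps)

lemma inner_conormal_dF: "z \<in> S \<Longrightarrow> inner (conormal z u) (dF z u) = (cmod u)\<^sup>2 * harmonic_jacobian h g z"
  using inner_dF_inv[of z u "dF z u"] jacobian_pos[of z]
  by (simp add: dF_inv_dF power2_norm_eq_inner field_simps)

text \<open>
  The sum on the right is \<open>- \<gamma>''\<close> and the conormal is \<open>- \<i> * \<gamma>'\<close>.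
\<close>

lemma curvature_form_eq:
  assumes "z \<in> S"
  shows "curvature_form h g z u = inner (conormal z u)
    (dF z u + (deriv (deriv h) z * u\<^sup>2 + cnj (deriv (deriv g) z * u\<^sup>2)))"
proof -
  define H G H2 G2 where HG: "H = deriv h z" "G = deriv g z" "H2 = deriv (deriv h) z" "G2 = deriv (deriv g) z"
  have "inner (H * u - cnj (G * u)) (H2 * u\<^sup>2 + cnj (G2 * u\<^sup>2))
      = (cmod u)\<^sup>2 * Re (u * (H2 * cnj H - G2 * cnj G)) - Re (u ^ 3 * (H2 * G - H * G2))"
    unfolding cmod_power2
    by (simp add: inner_complex_def power2_eq_square power3_eq_cube algebra_simps)
  then show ?thesis
    unfolding inner_add_right[of _ "dF z u"] inner_conormal_dF[OF assms]
    by (simp add: conormal_def curvature_form_def HG algebra_simps)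
qed

lemma F_along_curve:
  assumes "(c has_vector_derivative d) (at t)" "c t \<in> S"
  shows "((\<lambda>t. F (c t)) has_vector_derivative dF (c t) d) (at t)"
proof -
  have "((\<lambda>t. F (c t)) has_derivative (\<lambda>s. dF (c t) (s *\<^sub>R d))) (at t)"
    using has_derivative_compose[OF assms(1)[unfolded has_vector_derivative_def] F_has_derivative[OF assms(2)]] .
  then show ?thesis
    unfolding has_vector_derivative_def
    by (simp add: linear_cmul[OF bounded_linear.linear[OF bounded_linear_dF]])
qed

lemma dF_along_curve:
  assumes c: "(c has_vector_derivative d) (at t)" "c t \<in> S" and v: "(v has_vector_derivative w) (at t)"
  shows "((\<lambda>t. dF (c t) (v t)) has_vector_derivative
    dF (c t) w + (deriv (deriv h) (c t) * d * v t + cnj (deriv (deriv g) (c t) * d * v t))) (at t)"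
proof -
  have "((\<lambda>t. deriv h (c t)) has_vector_derivative d * deriv (deriv h) (c t)) (at t)"
    "((\<lambda>t. deriv g (c t)) has_vector_derivative d * deriv (deriv g) (c t)) (at t)"
    using field_vector_diff_chain_at[OF c(1) has_second_derivs(1)[OF c(2)]]
      field_vector_diff_chain_at[OF c(1) has_second_derivs(2)[OF c(2)]] by (simp_all add: o_def)
  from this(1)[THEN has_vector_derivative_mult, OF v] this(2)[THEN has_vector_derivative_mult, OF v]
  have "((\<lambda>t. deriv h (c t) * v t + cnj (deriv g (c t) * v t)) has_vector_derivative
      (deriv h (c t) * w + d * deriv (deriv h) (c t) * v t)
      + cnj (deriv g (c t) * w + d * deriv (deriv g) (c t) * v t)) (at t)"
    by (intro has_vector_derivative_add has_vector_derivative_cnj)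
  then show ?thesis by (simp add: dF_def algebra_simps)
qed

section \<open>From convex images to nonnegative curvature\<close>

text \<open>
  The function \<open>\<phi> t = - inner n (\<gamma> t)\<close> along the image curve has its maximum at \<open>0\<close> if \<open>n\<close> is an inner
  normal at \<open>F z\<close>. The first order condition makes \<open>n\<close> a real multiple \<open>\<sigma>\<close> of the conormal, the radial
  derivative shows \<open>\<sigma> < 0\<close>, and the second order condition is the claim.
\<close>

lemma curvature_form_nonneg:
  assumes ball: "ball a T \<subseteq> S" and conv: "\<And>r. \<lbrakk>0 < r; r < T\<rbrakk> \<Longrightarrow> convex (F ` ball a r)"
    and z: "z \<noteq> a" "dist a z < T"
  shows "0 \<le> curvature_form h g z (z - a)"
proof -
  define u r where "u = z - a" and "r = cmod u"
  have r: "0 < r" "r < T" "dist a z = r"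
    using z by (auto simp: u_def r_def dist_norm norm_minus_commute)
  have zS: "z \<in> S" using z ball by auto
  have cb: "cball a r \<subseteq> S" using r ball by force
  have inj: "inj_on F (cball a r)"
    using inj_on_cball_of_convex_images[OF ball conv, of r] r by simp
  have "F z \<notin> F ` ball a r"
  proof
    assume "F z \<in> F ` ball a r"
    then obtain x where "x \<in> ball a r" "F z = F x" by blast
    then show False using inj_onD[OF inj, of z x] r by auto
  qed
  then obtain n where n: "n \<noteq> 0" "\<And>x. x \<in> ball a r \<Longrightarrow> 0 \<le> inner n (F x - F z)"
    using supporting_normal[OF conv[OF r(1,2)]] by blast
  have n': "inner n (F z) \<le> inner n (F x)" if "x \<in> cball a r" for x
  proof -
    have cl: "closure (ball a r) = cball a r" using r by simp
    have "continuous_on (closure (ball a r)) (\<lambda>x. inner n (F x))"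
      unfolding cl by (intro continuous_intros continuous_on_subset[OF continuous_F cb])
    then show ?thesis
      using that n(2)
      by (intro continuous_ge_on_closure[of "ball a r" "\<lambda>x. inner n (F x)" x])
        (auto simp: cl inner_diff_right)
  qed
  define c where "c t = a + u * cis t" for t
  have cis: "((\<lambda>t. u * cis t) has_vector_derivative \<i> * (u * cis t)) (at t)" for t
  proof -
    have "((\<lambda>t. exp (\<i> * of_real t)) has_vector_derivative \<i> * exp (\<i> * of_real t)) (at t)"
      by (rule has_vector_derivative_real_field) (auto intro!: derivative_eq_intros)
    from has_vector_derivative_mult_right[OF this, of u] show ?thesis
      by (simp add: cis_conv_exp algebra_simps)
  qed
  have c: "(c has_vector_derivative \<i> * (u * cis t)) (at t)" for t
    unfolding c_def using has_vector_derivative_add[OF has_vector_derivative_const cis] by simp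
  have ccb: "c t \<in> cball a r" for t by (simp add: c_def r_def dist_norm norm_mult)
  have cS: "c t \<in> S" for t using ccb cb by blast
  have v: "((\<lambda>t. \<i> * (u * cis t)) has_vector_derivative - (u * cis t)) (at t)" for t
    using has_vector_derivative_mult_right[OF cis, of \<i>] by simp
  define A where "A = dF z u + (deriv (deriv h) z * u\<^sup>2 + cnj (deriv (deriv g) z * u\<^sup>2))"
  define \<phi> where "\<phi> t = - inner n (F (c t))" for t
  define \<phi>' where "\<phi>' t = - inner n (dF (c t) (\<i> * (u * cis t)))" for t
  have c0: "c 0 = z" by (simp add: c_def u_def)
  have d1: "(\<phi> has_real_derivative \<phi>' t) (at t)" for t
    unfolding \<phi>_def[abs_def] \<phi>'_def has_real_derivative_iff_has_vector_derivative
    by (intro has_vector_derivative_minus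
      bounded_linear.has_vector_derivative[OF bounded_linear_inner_right] F_along_curve c cS)
  have "((\<lambda>t. dF (c t) (\<i> * (u * cis t))) has_vector_derivative - A) (at 0)"
    using dF_along_curve[OF c cS v, of 0] linear_neg[OF bounded_linear.linear[OF bounded_linear_dF, of z]]
    by (simp add: c0 A_def power2_eq_square algebra_simps)
  then have d2: "(\<phi>' has_real_derivative - inner n (- A)) (at 0)"
    unfolding \<phi>'_def[abs_def] has_real_derivative_iff_has_vector_derivative
    by (intro has_vector_derivative_minus
      bounded_linear.has_vector_derivative[OF bounded_linear_inner_right])
  have max: "\<phi> t \<le> \<phi> 0" for t using n'[OF ccb[of t]] by (simp add: \<phi>_def c0)
  have "\<phi>' 0 = 0" "- inner n (- A) \<le> 0"
    using second_derivative_nonpos_at_local_max[where \<delta> = 1, OF d1 _ d2] max by auto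
  then have A: "inner n A \<le> 0" and orth: "inner n (\<i> * conormal z u) = 0"
    by (simp_all add: \<phi>'_def c0 dF_i)
  have radial: "inner n (dF z u) \<le> 0"
  proof (rule ccontr)
    assume "\<not> inner n (dF z u) \<le> 0"
    then have neg: "inner n (dF z (- u)) < 0"
      using linear_neg[OF bounded_linear.linear[OF bounded_linear_dF, of z]] by simp
    have "((\<lambda>t. inner n (F (z + t *\<^sub>R - u))) has_real_derivative inner n (dF z (- u))) (at 0)"
      unfolding has_real_derivative_iff_has_vector_derivative
      by (rule bounded_linear.has_vector_derivative[OF bounded_linear_inner_right F_line_derivative[OF zS]])
    from DERIV_neg_dec_right[OF this neg] obtain e where e: "e > 0"
        "\<And>t. \<lbrakk>t > 0; t < e\<rbrakk> \<Longrightarrow> inner n (F (z + t *\<^sub>R - u)) < inner n (F z)"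
      by auto
    define t where "t = min (e / 2) 1"
    have t: "0 < t" "t < e" "t \<le> 1" using e(1) by (auto simp: t_def)
    have "z + t *\<^sub>R - u - a = (1 - t) *\<^sub>R u" by (simp add: u_def algebra_simps)
    then have "cmod (z + t *\<^sub>R - u - a) \<le> r" using t by (simp add: r_def mult_left_le_one_le)
    then have "z + t *\<^sub>R - u \<in> cball a r" by (simp add: dist_norm norm_minus_commute)
    from n'[OF this] e(2)[OF t(1,2)] show False by simp
  qed
  have J: "0 < (cmod u)\<^sup>2 * harmonic_jacobian h g z"
    using r zS jacobian_pos by (simp add: r_def)
  define m where "m = conormal z u"
  have m: "inner m (dF z u) > 0" using J by (simp add: m_def inner_conormal_dF[OF zS])
  then have "m \<noteq> 0" by auto
  define \<sigma> where "\<sigma> = inner n m / inner m m"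
  have "n = \<sigma> *\<^sub>R m"
  proof -
    \<comment> \<open>The components of \<open>n\<close> along the orthogonal vectors \<open>m\<close> and \<open>\<i> * m\<close>; the second one vanishes.\<close>
    have "inner m m * Re n = inner n m * Re m + inner n (\<i> * m) * (- Im m)"
      "inner m m * Im n = inner n m * Im m + inner n (\<i> * m) * Re m"
      by (simp_all add: inner_complex_def algebra_simps)
    then have "inner m m * Re n = inner n m * Re m" "inner m m * Im n = inner n m * Im m"
      using orth by (simp_all add: m_def)
    then show ?thesis using \<open>m \<noteq> 0\<close> by (simp add: complex_eq_iff \<sigma>_def field_simps)
  qed
  with n(1) radial m have "\<sigma> < 0"
    by (cases "\<sigma> = 0") (auto simp: mult_le_0_iff not_le)
  with A \<open>n = \<sigma> *\<^sub>R m\<close> have "0 \<le> inner m A"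
    by (simp add: mult_le_0_iff)
  then show ?thesis
    unfolding m_def A_def curvature_form_eq[OF zS, symmetric] by (simp add: u_def)
qed

section \<open>From positive curvature to convex images\<close>

lemma dF_inv_along_curve_differentiable:
  assumes c: "(c has_vector_derivative d) (at t)" "c t \<in> S"
  shows "(\<lambda>t. dF_inv (c t) e) differentiable (at t)"
proof -
  have "((\<lambda>t. deriv h (c t)) has_vector_derivative d * deriv (deriv h) (c t)) (at t)"
    "((\<lambda>t. deriv g (c t)) has_vector_derivative d * deriv (deriv g) (c t)) (at t)"
    using field_vector_diff_chain_at[OF c(1) has_second_derivs(1)[OF c(2)]]
      field_vector_diff_chain_at[OF c(1) has_second_derivs(2)[OF c(2)]] by (simp_all add: o_def)
  then have *: "(\<lambda>t. deriv h (c t)) differentiable (at t)" "(\<lambda>t. deriv g (c t)) differentiable (at t)"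
    "(\<lambda>t. cnj (deriv h (c t))) differentiable (at t)" "(\<lambda>t. cnj (deriv g (c t))) differentiable (at t)"
    by (auto intro: differentiableI_vector has_vector_derivative_cnj)
  have "deriv h (c t) * cnj (deriv h (c t)) - deriv g (c t) * cnj (deriv g (c t)) \<noteq> 0"
    unfolding jacobian_complex[symmetric] using jacobian_pos[OF c(2)] by simp
  then show ?thesis
    unfolding dF_inv_def jacobian_complex
    by (intro differentiable_divide differentiable_diff differentiable_mult differentiable_const *)
qed

text \<open>
  The curve \<open>z\<close> is mapped by \<open>F\<close> to a segment with velocity \<open>e\<close>. At an interior critical point of the
  squared distance \<open>\<phi>\<close> to \<open>a\<close>, the velocity of \<open>z\<close> is a multiple \<open>\<kappa> * \<i> * (z - a)\<close>, and differentiating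
  the constant \<open>dF (z t) (z' t) = e\<close> yields \<open>\<phi>'' = 2 * \<kappa>\<^sup>2 / J * curvature_form > 0\<close>. If \<open>z = a\<close> there,
  then \<open>\<phi>'' = 2 * |z'|\<^sup>2 > 0\<close>. Hence no interior point is a maximum.
\<close>

lemma dist_along_segment_preimage:
  assumes z: "\<And>t. t \<in> {0..1} \<Longrightarrow> z t \<in> S"
      "\<And>t. t \<in> {0..1} \<Longrightarrow> (z has_vector_derivative dF_inv (z t) e) (at t)"
    and "e \<noteq> 0"
    and curv: "\<And>t. \<lbrakk>t \<in> {0..1}; z t \<noteq> a\<rbrakk> \<Longrightarrow> 0 < curvature_form h g (z t) (z t - a)"
    and t: "t \<in> {0..1}"
  shows "dist a (z t) \<le> max (dist a (z 0)) (dist a (z 1))"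
proof -
  define \<phi> where "\<phi> t = inner (z t - a) (z t - a)" for t
  define V where "V t = dF_inv (z t) e" for t
  have \<phi>: "\<phi> t = (dist a (z t))\<^sup>2" for t
    by (simp add: \<phi>_def power2_norm_eq_inner[symmetric] dist_norm norm_minus_commute)
  have "continuous_on {0..1} z"
    using z(2) by (intro continuous_at_imp_continuous_on ballI has_vector_derivative_continuous) auto
  then have "continuous_on {0..1} \<phi>" unfolding \<phi>_def by (intro continuous_intros)
  then obtain c where c: "c \<in> {0..1}" "\<And>s. s \<in> {0..1} \<Longrightarrow> \<phi> s \<le> \<phi> c"
    using continuous_attains_sup[of "{0..1::real}" \<phi>] by auto
  have "c = 0 \<or> c = 1"
  proof (rule ccontr)
    assume ends: "\<not> (c = 0 \<or> c = 1)"
    define \<delta> where "\<delta> = min c (1 - c)"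
    have "\<delta> > 0" using c(1) ends by (auto simp: \<delta>_def)
    have near: "s \<in> {0..1}" if "\<bar>s - c\<bar> < \<delta>" for s using that by (auto simp: \<delta>_def abs_if split: if_splits)
    define \<phi>' where "\<phi>' t = 2 * inner (z t - a) (V t)" for t
    have d1: "(\<phi> has_real_derivative \<phi>' s) (at s)" if "\<bar>s - c\<bar> < \<delta>" for s
    proof -
      have "((\<lambda>t. z t - a) has_vector_derivative V s) (at s)"
        using z(2)[OF near[OF that]] unfolding V_def by (auto intro!: derivative_eq_intros)
      from bounded_bilinear.has_vector_derivative[OF bounded_bilinear_inner this this] show ?thesis
        unfolding has_real_derivative_iff_has_vector_derivative \<phi>_def \<phi>'_def
        by (simp add: inner_commute)
    qed
    have zc: "z c \<in> S" using z c(1) by auto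
    define V' where "V' = vector_derivative V (at c)"
    have V': "(V has_vector_derivative V') (at c)"
      unfolding V'_def V_def
      using dF_inv_along_curve_differentiable[OF z(2)[OF c(1)] zc] vector_derivative_works by blast
    have d2: "(\<phi>' has_real_derivative 2 * (inner (z c - a) V' + inner (V c) (V c))) (at c)"
    proof -
      have "((\<lambda>t. z t - a) has_vector_derivative V c) (at c)"
        using z(2)[OF c(1)] unfolding V_def by (auto intro!: derivative_eq_intros)
      from bounded_bilinear.has_vector_derivative[OF bounded_bilinear_inner this V'] show ?thesis
        unfolding has_real_derivative_iff_has_vector_derivative \<phi>'_def
        by (intro has_vector_derivative_mult_right)
    qed
    have max: "\<phi> s \<le> \<phi> c" if "\<bar>s - c\<bar> < \<delta>" for s using c(2) near[OF that] by blast
    note test = second_derivative_nonpos_at_local_max[OF d1 \<open>\<delta> > 0\<close> d2 max]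
    define u where "u = z c - a"
    define B where "B = deriv (deriv h) (z c) * u\<^sup>2 + cnj (deriv (deriv g) (z c) * u\<^sup>2)"
    have orth: "inner u (V c) = 0" using test(1) by (simp add: \<phi>'_def u_def)
    have le: "inner u V' + inner (V c) (V c) \<le> 0" using test(2) by (simp add: u_def)
    have dFV: "dF (z c) (V c) = e" using zc by (simp add: V_def dF_dF_inv)
    have "V c \<noteq> 0" using dFV \<open>e \<noteq> 0\<close> by (auto simp: dF_def)
    then have pos: "inner (V c) (V c) > 0" by simp
    show False
    proof (cases "u = 0")
      case True
      then show False using le pos by simp
    next
      case False
      define \<kappa> where "\<kappa> = inner (V c) (\<i> * u) / inner u u"
      have V: "V c = \<kappa> *\<^sub>R (\<i> * u)"
      proof -
        \<comment> \<open>The velocity in the orthogonal frame \<open>u\<close>, \<open>\<i> * u\<close>; its component along \<open>u\<close> vanishes.\<close>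
        have "inner u u * Re (V c) = inner (V c) (\<i> * u) * (- Im u) + inner u (V c) * Re u"
          "inner u u * Im (V c) = inner (V c) (\<i> * u) * Re u + inner u (V c) * Im u"
          by (simp_all add: inner_complex_def algebra_simps)
        then show ?thesis using False orth by (simp add: complex_eq_iff \<kappa>_def field_simps)
      qed
      then have "\<kappa> \<noteq> 0" using \<open>V c \<noteq> 0\<close> by auto
      have V2: "V c * V c = - of_real (\<kappa>\<^sup>2) * u\<^sup>2"
        by (simp add: V scaleR_conv_of_real power2_eq_square algebra_simps)
      have D: "((\<lambda>t. dF (z t) (V t)) has_vector_derivative dF (z c) V'
          + (deriv (deriv h) (z c) * V c * V c + cnj (deriv (deriv g) (z c) * V c * V c))) (at c)"
        using dF_along_curve[OF z(2)[OF c(1)] zc V'] by (simp add: V_def)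
      have "((\<lambda>t. dF (z t) (V t)) has_vector_derivative 0) (at c)"
      proof (rule has_vector_derivative_transform_within_open[where f = "\<lambda>_. e" and S = "{0<..<1}"])
        show "c \<in> {0<..<1}" using c(1) ends by auto
        show "e = dF (z s) (V s)" if "s \<in> {0<..<1}" for s
          using that z(1)[of s] by (simp add: V_def dF_dF_inv)
      qed auto
      from vector_derivative_unique_at[OF D this]
      have "dF (z c) V' = - (deriv (deriv h) (z c) * (V c * V c) + cnj (deriv (deriv g) (z c) * (V c * V c)))"
        by (simp add: mult.assoc add_eq_0_iff2)
      also have "\<dots> = \<kappa>\<^sup>2 *\<^sub>R B"
        unfolding V2 B_def by (simp add: scaleR_conv_of_real algebra_simps)
      finally have "V' = dF_inv (z c) (\<kappa>\<^sup>2 *\<^sub>R B)" using dF_inv_dF[OF zc] by metis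
      then have "inner u V' = \<kappa>\<^sup>2 * inner (conormal (z c) u) B / harmonic_jacobian h g (z c)"
        by (simp add: inner_dF_inv[OF zc])
      moreover have "inner (V c) (V c) = \<kappa>\<^sup>2 * (cmod u)\<^sup>2"
        unfolding V power2_norm_eq_inner[symmetric] by (simp add: norm_mult power_mult_distrib)
      ultimately have "harmonic_jacobian h g (z c) * (inner u V' + inner (V c) (V c))
          = \<kappa>\<^sup>2 * curvature_form h g (z c) u"
        using jacobian_pos[OF zc] unfolding curvature_form_eq[OF zc] B_def[symmetric] inner_add_right
          inner_conormal_dF[OF zc] by (simp add: field_simps)
      moreover have "0 < \<kappa>\<^sup>2 * curvature_form h g (z c) u"
        using curv[OF c(1)] False \<open>\<kappa> \<noteq> 0\<close> by (simp add: u_def)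
      ultimately show False
        using le jacobian_pos[OF zc] by (metis mult_le_0_iff less_le_not_le not_less zero_less_mult_pos)
    qed
  qed
  then have "\<phi> t \<le> \<phi> 0 \<or> \<phi> t \<le> \<phi> 1" using c(2)[OF t] by auto
  then show ?thesis unfolding \<phi> by (auto simp: le_max_iff_disj dest: power2_le_imp_le)
qed

text \<open>
  The neighbourhood \<open>N\<close> of the compact convex image \<open>K\<close> is convex and still inside the injective image
  of an open disc \<open>U\<close>. For a radius so close to \<open>r\<close> that the larger disc is mapped into \<open>N\<close>, a segment
  between two of its image points lies in \<open>N\<close> and has a preimage in \<open>U\<close>, which cannot leave the larger
  disc by \<open>dist_along_segment_preimage\<close>. The case \<open>r = 0\<close> is included and starts the continuity method.
\<close>

lemma convex_image_slightly_larger_cball: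
  assumes S: "ball a T \<subseteq> S"
    and curv: "\<And>z. \<lbrakk>z \<in> ball a T; z \<noteq> a\<rbrakk> \<Longrightarrow> 0 < curvature_form h g z (z - a)"
    and r: "0 \<le> r" "r < T" and inj: "inj_on F (cball a r)" and conv: "convex (F ` cball a r)"
  shows "\<exists>e>0. \<forall>s. r < s \<and> s < r + e \<longrightarrow> inj_on F (cball a s) \<and> convex (F ` cball a s)"
proof -
  have cS: "cball a r \<subseteq> S" using S r by force
  obtain R0 where R0: "r < R0" "ball a R0 \<subseteq> S" "inj_on F (ball a R0)"
    by (rule inj_on_larger_ball[OF inj r(1) cS])
  define U where "U = ball a (min R0 T)"
  have U: "open U" "U \<subseteq> S" "inj_on F U" "cball a r \<subseteq> U" "U \<subseteq> ball a T"
    using R0 S r by (auto simp: U_def intro: inj_on_subset)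
  define K where "K = F ` cball a r"
  have "compact K"
    unfolding K_def by (intro compact_continuous_image continuous_on_subset[OF continuous_F cS]) simp
  moreover have "open (F ` U)" using U(1,2) by (rule open_image)
  moreover have "K \<subseteq> F ` U" using U(4) by (auto simp: K_def)
  ultimately obtain \<epsilon> where \<epsilon>: "\<epsilon> > 0" "(\<Union>x\<in>K. ball x \<epsilon>) \<subseteq> F ` U"
    by (rule compact_subset_open_imp_ball_epsilon_subset)
  define N where "N = (\<Union>x\<in>K. ball x \<epsilon>)"
  have "N = (\<Union>x\<in>K. \<Union>y\<in>ball 0 \<epsilon>. {x + y})"
  proof (intro equalityI subsetI)
    fix w assume "w \<in> N"
    then obtain x where "x \<in> K" "dist x w < \<epsilon>" by (auto simp: N_def)
    then show "w \<in> (\<Union>x\<in>K. \<Union>y\<in>ball 0 \<epsilon>. {x + y})"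
      by (intro UN_I[of x] UN_I[of "w - x"]) (auto simp: dist_norm norm_minus_commute)
  qed (force simp: N_def dist_norm)
  then have "convex N" using convex_sums[OF conv[folded K_def] convex_ball[of 0 \<epsilon>]] by simp
  define M where "M = U \<inter> F -` N"
  have "open M"
    unfolding M_def using U(1,2)
    by (intro continuous_open_preimage continuous_on_subset[OF continuous_F]) (auto simp: N_def)
  moreover have "cball a r \<subseteq> M"
    using U(4) \<epsilon>(1) by (force simp: M_def N_def K_def)
  ultimately obtain R1 where R1: "r < R1" "ball a R1 \<subseteq> M"
    using cball_subset_open_imp_ball_subset[OF _ _ r(1)] by metis
  have "inj_on F (cball a s) \<and> convex (F ` cball a s)" if s: "r < s" "s < R1" for s
  proof
    have sM: "cball a s \<subseteq> M" using R1(2) s(2) by force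
    then show "inj_on F (cball a s)" by (intro inj_on_subset[OF U(3)]) (auto simp: M_def)
    show "convex (F ` cball a s)"
    proof (unfold convex_contains_segment, intro ballI subsetI)
      fix w0 w1 y assume "w0 \<in> F ` cball a s" "w1 \<in> F ` cball a s" and y: "y \<in> closed_segment w0 w1"
      then obtain p q where pq: "p \<in> cball a s" "q \<in> cball a s" "w0 = F p" "w1 = F q" by blast
      show "y \<in> F ` cball a s"
      proof (cases "w0 = w1")
        case True
        then show ?thesis using y pq by auto
      next
        case False
        define l where "l t = w0 + t *\<^sub>R (w1 - w0)" for t
        have "closed_segment w0 w1 \<subseteq> N"
          using pq sM by (intro closed_segment_subset \<open>convex N\<close>) (auto simp: M_def)
        moreover have "l t \<in> closed_segment w0 w1" if "t \<in> {0..1}" for t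
          using that unfolding closed_segment_def l_def by (auto simp: algebra_simps intro!: exI[of _ t])
        ultimately have l: "l t \<in> F ` U" if "t \<in> {0..1}" for t
          using \<epsilon>(2) that unfolding N_def by blast
        define z where "z t = inv_into U F (l t)" for t
        have zU: "z t \<in> U" "F (z t) = l t" if "t \<in> {0..1}" for t
          using l[OF that] by (auto simp: z_def intro: inv_into_into f_inv_into_f)
        have der: "(z has_vector_derivative dF_inv (z t) (w1 - w0)) (at t)" if "t \<in> {0..1}" for t
        proof -
          have "(l has_derivative (\<lambda>x. x *\<^sub>R (w1 - w0))) (at t)"
            unfolding l_def by (auto intro!: derivative_eq_intros)
          from has_derivative_compose[OF this has_derivative_inv_into_F[OF U(1,2,3) l[OF that]]]
          show ?thesis
            by (simp add: has_vector_derivative_def z_def[abs_def] dF_inv_scaleR)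
        qed
        obtain t where t: "t \<in> {0..1}" "y = l t"
          using y unfolding closed_segment_def l_def by (auto simp: algebra_simps)
        have "dist a (z t) \<le> max (dist a (z 0)) (dist a (z 1))"
        proof (rule dist_along_segment_preimage[OF _ der _ _ t(1)])
          show "z t \<in> S" if "t \<in> {0..1}" for t using zU[OF that] U by blast
          show "w1 - w0 \<noteq> 0" using False by simp
          show "0 < curvature_form h g (z t) (z t - a)" if "t \<in> {0..1}" "z t \<noteq> a" for t
            using curv zU[OF that(1)] U that by blast
        qed
        moreover have "z 0 = p" "z 1 = q"
          using pq sM inv_into_f_f[OF U(3)] by (auto simp: z_def l_def M_def)
        ultimately have "z t \<in> cball a s" using pq by auto
        then show ?thesis using zU[OF t(1)] t(2) by (metis imageI)
      qed
    qed
  qed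
  then show ?thesis using R1(1) by (intro exI[of _ "R1 - r"]) auto
qed

text \<open>
  Convexity and injectivity are carried along together: the step to larger radii needs injectivity in
  order to preserve convexity, and the passage to the limit needs convexity in order to preserve
  injectivity.
\<close>

lemma convex_images_of_curvature_pos:
  assumes S: "ball a T \<subseteq> S"
    and curv: "\<And>z. \<lbrakk>z \<in> ball a T; z \<noteq> a\<rbrakk> \<Longrightarrow> 0 < curvature_form h g z (z - a)"
    and r: "0 \<le> r" "r < T"
  shows "convex (F ` cball a r)"
proof -
  have sub: "cball a s \<subseteq> S" if "s < T" for s using that S by force
  have "inj_on F (cball a r) \<and> convex (F ` cball a r)"
  proof (rule real_interval_induct[where G = "\<lambda>r. inj_on F (cball a r) \<and> convex (F ` cball a r)" and T = T])
    show "inj_on F (cball a 0) \<and> convex (F ` cball a 0)" by simp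
  next
    fix s assume "0 \<le> s" "s < T" "inj_on F (cball a s) \<and> convex (F ` cball a s)"
    then show "\<exists>e>0. \<forall>s'. s < s' \<and> s' < s + e \<longrightarrow> inj_on F (cball a s') \<and> convex (F ` cball a s')"
      using convex_image_slightly_larger_cball[OF S curv] by blast
  next
    fix s assume s: "0 < s" "s < T"
      and less: "\<And>s'. \<lbrakk>0 \<le> s'; s' < s\<rbrakk> \<Longrightarrow> inj_on F (cball a s') \<and> convex (F ` cball a s')"
    have inj: "inj_on F (ball a s)" using less by (intro inj_on_ball_of_cballs) blast
    have conv: "convex (F ` ball a s)" using less by (intro convex_image_ball_of_cballs) blast
    have cont: "continuous_on (cball a s) F" by (rule continuous_on_subset[OF continuous_F sub[OF s(2)]])
    have "closure (F ` ball a s) = F ` cball a s"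
    proof
      show "closure (F ` ball a s) \<subseteq> F ` cball a s"
        by (intro closure_minimal image_mono ball_subset_cball compact_imp_closed
          compact_continuous_image[OF cont] compact_cball)
      have "F ` closure (ball a s) \<subseteq> closure (F ` ball a s)"
        using cont s(1) by (intro image_closure_subset closure_subset closed_closure) simp
      then show "F ` cball a s \<subseteq> closure (F ` ball a s)" using s(1) by simp
    qed
    then show "inj_on F (cball a s) \<and> convex (F ` cball a s)"
      using inj_on_cball_of_convex_image[OF sub[OF s(2)] s(1) inj conv] convex_closure[OF conv] by simp
  qed (use r in auto)
  then show ?thesis ..
qed

end

section \<open>Euclidean and hyperbolic circles in the disc\<close>

text \<open>
  The set \<open>|(z - b) / (1 - z * cnj b)| = const\<close> through \<open>\<zeta>\<close> is a hyperbolic circle with hyperbolic centre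
  \<open>b\<close>. It is also a Euclidean circle, whose centre \<open>euclidean_centre b \<zeta>\<close> depends on the
  radius and therefore on \<open>\<zeta>\<close>. The number \<open>hyperbolic_denom b \<zeta>\<close> is the real part of the derivative of
  \<open>(\<zeta> - b) * (1 - \<zeta> * cnj b)\<close> with respect to \<open>\<zeta>\<close>.
\<close>

definition hyperbolic_denom :: "complex \<Rightarrow> complex \<Rightarrow> real"
  where "hyperbolic_denom b \<zeta> = 1 + (cmod b)\<^sup>2 - 2 * Re (cnj b * \<zeta>)"

definition euclidean_centre :: "complex \<Rightarrow> complex \<Rightarrow> complex"
  where "euclidean_centre b \<zeta> = of_real ((1 - (cmod \<zeta>)\<^sup>2) / hyperbolic_denom b \<zeta>) * b"

lemma norm_sq_diff_mult_cnj:
  "(cmod (1 - \<zeta> * cnj b))\<^sup>2 - (cmod (\<zeta> - b))\<^sup>2 = (1 - (cmod \<zeta>)\<^sup>2) * (1 - (cmod b)\<^sup>2)"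
  unfolding cmod_power2 by (simp add: power2_eq_square algebra_simps)

lemma hyperbolic_denom_eq:
  "hyperbolic_denom b \<zeta> = (cmod (1 - \<zeta> * cnj b))\<^sup>2 + (cmod b)\<^sup>2 * (1 - (cmod \<zeta>)\<^sup>2)"
  unfolding hyperbolic_denom_def cmod_power2 by (simp add: power2_eq_square algebra_simps)

lemma hyperbolic_denom_pos:
  assumes "cmod \<zeta> < 1" "cmod b < 1"
  shows "hyperbolic_denom b \<zeta> > 0"
proof -
  have "cmod (\<zeta> * cnj b) < 1"
    using assms mult_strict_mono'[of "cmod \<zeta>" 1 "cmod b" 1] by (simp add: norm_mult)
  then have "1 - \<zeta> * cnj b \<noteq> 0" by auto
  then have "(cmod (1 - \<zeta> * cnj b))\<^sup>2 > 0" by simp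
  moreover have "(cmod b)\<^sup>2 * (1 - (cmod \<zeta>)\<^sup>2) \<ge> 0" using assms by (simp add: power_le_one)
  ultimately show ?thesis unfolding hyperbolic_denom_eq by linarith
qed

lemma diff_euclidean_centre:
  assumes "cmod \<zeta> < 1" "cmod b < 1"
  shows "\<zeta> - euclidean_centre b \<zeta> = (\<zeta> - b) * (1 - \<zeta> * cnj b) / of_real (hyperbolic_denom b \<zeta>)"
proof -
  have "\<zeta> * of_real (hyperbolic_denom b \<zeta>) - of_real (1 - (cmod \<zeta>)\<^sup>2) * b
      = (\<zeta> - b) * (1 - \<zeta> * cnj b)"
    unfolding hyperbolic_denom_def cmod_power2
    by (simp add: complex_eq_iff power2_eq_square algebra_simps)
  then show ?thesis
    using hyperbolic_denom_pos[OF assms] by (simp add: euclidean_centre_def field_simps)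
qed

text \<open>
  Multiplied by \<open>(1 + |b|) * hyperbolic_denom b \<zeta>\<close>, the gap \<open>1 - |a| - r\<close> factors as \<open>(Y - X) * (Y - |b| * X)\<close>, where
  \<open>X = |\<zeta> - b|\<close> is smaller than \<open>Y = |1 - \<zeta> * cnj b|\<close>.
\<close>

lemma euclidean_circle_in_disc:
  assumes "cmod \<zeta> < 1" "cmod b < 1"
  shows "cmod (euclidean_centre b \<zeta>) + cmod (\<zeta> - euclidean_centre b \<zeta>) < 1"
proof -
  define X Y B L where "X = cmod (\<zeta> - b)" "Y = cmod (1 - \<zeta> * cnj b)" "B = cmod b"
    "L = hyperbolic_denom b \<zeta>"
  note defs = this
  have L: "L > 0" using hyperbolic_denom_pos[OF assms] by (simp add: defs)
  define P where "P = 1 - (cmod \<zeta>)\<^sup>2"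
  have P: "P > 0" using assms by (simp add: P_def abs_square_less_1)
  have B: "0 \<le> B" "B < 1" using assms by (simp_all add: defs)
  then have B2: "1 - B\<^sup>2 > 0" by (simp add: abs_square_less_1)
  have YX: "Y\<^sup>2 - X\<^sup>2 = P * (1 - B\<^sup>2)" using norm_sq_diff_mult_cnj by (simp add: defs P_def)
  have "P * (1 - B\<^sup>2) > 0" using P B2 by simp
  then have "X\<^sup>2 < Y\<^sup>2" using YX by simp
  then have XY: "X < Y" by (rule power2_less_imp_less) (simp add: defs)
  have X0: "X \<ge> 0" by (simp add: defs)
  have "(1 + B) * (L - B * P - X * Y) = (Y - X) * (Y - B * X)"
  proof -
    have "L = Y\<^sup>2 + B\<^sup>2 * P" using hyperbolic_denom_eq by (simp add: defs P_def)
    then have "(1 + B) * (L - B * P - X * Y) = (1 + B) * (Y\<^sup>2 - X * Y) - B * (P * (1 - B\<^sup>2))"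
      by (simp add: power2_eq_square algebra_simps)
    also have "\<dots> = (Y - X) * (Y - B * X)"
      unfolding YX[symmetric] by (simp add: power2_eq_square algebra_simps)
    finally show ?thesis .
  qed
  moreover have "Y - B * X > 0"
    using mult_right_mono[of B 1 X] B X0 XY by simp
  ultimately have "(1 + B) * (L - B * P - X * Y) > 0" using XY by simp
  then have "B * P + X * Y < L" using B by (simp add: zero_less_mult_iff)
  moreover have "cmod (euclidean_centre b \<zeta>) = B * P / L"
    using L P by (simp add: euclidean_centre_def norm_mult norm_divide defs[symmetric] P_def[symmetric] del: of_real_diff of_real_power)
  moreover have "cmod (\<zeta> - euclidean_centre b \<zeta>) = X * Y / L"
    unfolding diff_euclidean_centre[OF assms] using L
    by (simp add: norm_mult norm_divide defs[symmetric])
  ultimately show ?thesis using L by (simp add: add_divide_distrib[symmetric])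
qed

text \<open>
  The hyperbolic centre is sought on the ray through \<open>a\<close>. For \<open>b = \<beta> * a\<close> the condition becomes the
  quadratic equation \<open>|a|\<^sup>2 * \<beta>\<^sup>2 - (1 + |a|\<^sup>2 - r\<^sup>2) * \<beta> + 1 = 0\<close>. It has a root between \<open>0\<close>, where the left
  side is \<open>1\<close>, and \<open>1 / |a|\<close>, where it is negative because \<open>r < 1 - |a|\<close>.
\<close>

lemma euclidean_centre_surj:
  assumes "cmod a + cmod (\<zeta> - a) < 1"
  obtains b where "cmod b < 1" "euclidean_centre b \<zeta> = a"
proof (cases "a = 0")
  case True
  then show thesis by (intro that[of 0]) (simp_all add: euclidean_centre_def)
next
  case False
  define A r where "A = cmod a" and "r = cmod (\<zeta> - a)"
  have "0 < A" "0 \<le> r" "A + r < 1" using False assms by (simp_all add: A_def r_def)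
  then have A: "0 < A" "A < 1" "0 \<le> r" "r < 1 - A" by linarith+
  have \<zeta>: "cmod \<zeta> < 1" using assms norm_triangle_ineq[of a "\<zeta> - a"] by simp
  define P where "P \<beta> = A\<^sup>2 * \<beta>\<^sup>2 - (1 + A\<^sup>2 - r\<^sup>2) * \<beta> + 1" for \<beta> :: real
  have "r\<^sup>2 < (1 - A)\<^sup>2" using A by (intro power_strict_mono) auto
  then have "2 * A < 1 + A\<^sup>2 - r\<^sup>2" by (simp add: power2_eq_square algebra_simps)
  then have neg: "P (1 / A) < 0" using A by (simp add: P_def field_simps power2_eq_square)
  have "\<exists>\<beta>. 0 \<le> \<beta> \<and> \<beta> \<le> 1 / A \<and> P \<beta> = 0"
    using A neg by (intro IVT2) (auto simp: P_def intro!: continuous_intros)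
  then obtain \<beta> where \<beta>: "0 \<le> \<beta>" "\<beta> \<le> 1 / A" "P \<beta> = 0" by blast
  have "\<beta> \<noteq> 0" "\<beta> \<noteq> 1 / A" using \<beta> neg by (auto simp: P_def)
  with \<beta> have b: "0 < \<beta>" "\<beta> * A < 1" using A by (auto simp: field_simps order_less_le)
  define b where "b = of_real \<beta> * a"
  have "cmod b = \<beta> * A" using b by (simp add: b_def A_def norm_mult)
  have rel: "r\<^sup>2 = (cmod \<zeta>)\<^sup>2 - 2 * Re (cnj a * \<zeta>) + A\<^sup>2"
    unfolding r_def A_def cmod_power2 by (simp add: power2_eq_square algebra_simps)
  have "hyperbolic_denom b \<zeta> = 1 + A\<^sup>2 * \<beta>\<^sup>2 - 2 * \<beta> * Re (cnj a * \<zeta>)"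
    unfolding hyperbolic_denom_def \<open>cmod b = \<beta> * A\<close> by (simp add: b_def power_mult_distrib algebra_simps)
  also have "\<dots> = \<beta> * (1 - (cmod \<zeta>)\<^sup>2)"
    using \<beta>(3) rel by (simp add: P_def algebra_simps)
  finally have "hyperbolic_denom b \<zeta> = \<beta> * (1 - (cmod \<zeta>)\<^sup>2)" .
  moreover have "1 - (cmod \<zeta>)\<^sup>2 > 0" using \<zeta> by (simp add: abs_square_less_1)
  ultimately have "(1 - (cmod \<zeta>)\<^sup>2) / hyperbolic_denom b \<zeta> = 1 / \<beta>" using b by simp
  then have "euclidean_centre b \<zeta> = a" using b by (simp add: euclidean_centre_def b_def)
  then show thesis using that[of b] b \<open>cmod b = \<beta> * A\<close> by simp
qed

text \<open>
  With \<open>w = (\<zeta> - b) * (1 - \<zeta> * cnj b)\<close> and \<open>L = hyperbolic_denom b \<zeta>\<close> one has \<open>\<zeta> - a = w / L\<close> for the Euclidean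
  centre \<open>a\<close>, and the difference of the two sides is \<open>L\<^sup>3 / |w|\<^sup>2\<close> times the curvature form at \<open>w / L\<close>.
\<close>

lemma absolute_convexity_ineq_iff:
  assumes \<zeta>: "cmod \<zeta> < 1" and b: "cmod b < 1" and "\<zeta> \<noteq> b"
  shows "absolute_convexity_ineq h g \<zeta> b \<longleftrightarrow>
    0 \<le> curvature_form h g \<zeta> (\<zeta> - euclidean_centre b \<zeta>)"
proof -
  define w where "w = (\<zeta> - b) * (1 - \<zeta> * cnj b)"
  define L where "L = hyperbolic_denom b \<zeta>"
  define H G H2 G2 where HG: "H = deriv h \<zeta>" "G = deriv g \<zeta>" "H2 = deriv (deriv h) \<zeta>" "G2 = deriv (deriv g) \<zeta>"
  have L: "L > 0" using hyperbolic_denom_pos[OF \<zeta> b] by (simp add: L_def)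
  have "1 - \<zeta> * cnj b \<noteq> 0"
  proof
    assume "1 - \<zeta> * cnj b = 0"
    then have "cmod \<zeta> * cmod b = 1" by (metis complex_mod_cnj eq_iff_diff_eq_0 norm_mult norm_one)
    then show False using \<zeta> b mult_strict_mono'[of "cmod \<zeta>" 1 "cmod b" 1] by simp
  qed
  then have "w \<noteq> 0" using \<open>\<zeta> \<noteq> b\<close> by (simp add: w_def)
  then have w2: "(cmod w)\<^sup>2 > 0" by simp
  have term_eq: "(cmod x)\<^sup>2 * (1 + (cmod b)\<^sup>2 + Re (w * y / x - 2 * cnj b * \<zeta>))
      = (cmod x)\<^sup>2 * L + Re (w * (y * cnj x))" for x y
  proof -
    have "(cmod x)\<^sup>2 * Re (w * y / x) = Re (w * y * cnj x)"
      unfolding complex_div_cnj[of "w * y" x] by (cases "x = 0") simp_all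
    then show ?thesis by (simp add: L_def hyperbolic_denom_def algebra_simps)
  qed
  have cube: "(\<zeta> - b) ^ 3 * (1 - \<zeta> * cnj b) ^ 3
      / complex_of_real ((cmod (\<zeta> - b))\<^sup>2 * (cmod (1 - \<zeta> * cnj b))\<^sup>2)
      = w ^ 3 / of_real ((cmod w)\<^sup>2)"
    by (simp add: w_def norm_mult power_mult_distrib)
  have "absolute_convexity_ineq h g \<zeta> b \<longleftrightarrow>
      0 \<le> ((cmod H)\<^sup>2 * L + Re (w * (H2 * cnj H))) - ((cmod G)\<^sup>2 * L + Re (w * (G2 * cnj G)))
        - Re (w ^ 3 * (H2 * G - H * G2)) / (cmod w)\<^sup>2" (is "_ \<longleftrightarrow> 0 \<le> ?Q")
    unfolding absolute_convexity_ineq_def cube w_def[symmetric] term_eq HG[symmetric]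
    by (simp add: times_divide_eq_left Re_divide_of_real algebra_simps del: of_real_power)
  also have "?Q = (L ^ 3 / (cmod w)\<^sup>2) * curvature_form h g \<zeta> (of_real (1 / L) * w)"
  proof -
    define X where "X = Re (w * (H2 * cnj H)) - Re (w * (G2 * cnj G))"
    define J where "J = harmonic_jacobian h g \<zeta>"
    define Y where "Y = Re (w ^ 3 * (H2 * G - H * G2))"
    define N where "N = (cmod w)\<^sup>2"
    have "N \<noteq> 0" using w2 by (simp add: N_def)
    have cf: "curvature_form h g \<zeta> w = (cmod w)\<^sup>2 * (J + X) - Y"
      unfolding curvature_form_def X_def Y_def J_def HG right_diff_distrib[of w] by simp
    have "(L ^ 3 / (cmod w)\<^sup>2) * curvature_form h g \<zeta> (of_real (1 / L) * w)
        = J * L + X - Y / (cmod w)\<^sup>2"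
      unfolding curvature_form_scale J_def[symmetric] cf N_def[symmetric]
      using L \<open>N \<noteq> 0\<close> by (simp add: field_simps power2_eq_square power3_eq_cube)
    also have "\<dots> = ?Q"
      by (simp add: J_def X_def Y_def harmonic_jacobian_def HG algebra_simps)
    finally show ?thesis by simp
  qed
  also have "0 \<le> \<dots> \<longleftrightarrow> 0 \<le> curvature_form h g \<zeta> (of_real (1 / L) * w)"
  proof -
    have "0 < L ^ 3 / (cmod w)\<^sup>2" using L w2 by simp
    moreover have "0 \<le> c * x \<longleftrightarrow> 0 \<le> x" if "0 < c" for c x :: real
      using that by (simp add: zero_le_mult_iff)
    ultimately show ?thesis by blast
  qed
  also have "of_real (1 / L) * w = \<zeta> - euclidean_centre b \<zeta>"
    unfolding diff_euclidean_centre[OF \<zeta> b] by (simp add: w_def L_def)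
  finally show ?thesis .
qed

section \<open>Absolute convexity\<close>

lemma sub_disc_eq_ball: "r \<le> 1 - cmod a \<Longrightarrow> sub_disc a r = ball a r"
proof (intro equalityI subsetI)
  fix z assume r: "r \<le> 1 - cmod a" and z: "z \<in> ball a r"
  have "cmod z \<le> cmod a + cmod (z - a)" using norm_triangle_ineq[of a "z - a"] by simp
  then show "z \<in> sub_disc a r"
    using r z by (simp add: sub_disc_def dist_norm norm_minus_commute)
qed (simp add: sub_disc_def dist_norm norm_minus_commute)

theorem theorem1:
  fixes f h g :: "complex \<Rightarrow> complex"
  assumes "harmonic_decomposition f h g"
    and "sense_preserving h g"
  shows "(f \<in> AK_H \<longleftrightarrow> f \<in> AK_H_tilde) \<and>
    (f \<in> AK_H_tilde \<longleftrightarrow>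
      (\<forall>\<zeta>\<in>\<bbbD>. \<forall>b\<in>\<bbbD>. \<zeta> \<noteq> b \<longrightarrow> absolute_convexity_ineq h g \<zeta> b))"
proof -
  have disc: "\<bbbD> = ball 0 1" by auto
  interpret sense_preserving_on h g \<bbbD>
  proof
    show "open \<bbbD>" unfolding disc by simp
    show "h holomorphic_on \<bbbD>" "g holomorphic_on \<bbbD>"
      using assms(1) unfolding harmonic_decomposition_def by blast+
    show "harmonic_jacobian h g z > 0" if "z \<in> \<bbbD>" for z
      using assms(2) that unfolding sense_preserving_def by blast
  qed
  have fF: "f z = F z" if "z \<in> \<bbbD>" for z
    using assms(1) that unfolding harmonic_decomposition_def F_def by blast
  have ball: "ball a (1 - cmod a) \<subseteq> \<bbbD>" for a
    using sub_disc_eq_ball[of "1 - cmod a" a] by (auto simp: sub_disc_def)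
  have image: "f ` sub_disc a r = F ` ball a r" if "r \<le> 1 - cmod a" for a r
    unfolding sub_disc_eq_ball[OF that, symmetric]
    by (intro image_cong refl fF) (simp add: sub_disc_def)
  have lu: "locally_univalent f"
    unfolding locally_univalent_def
  proof
    fix z assume "z \<in> \<bbbD>"
    then obtain U where U: "open U" "z \<in> U" "U \<subseteq> \<bbbD>" "inj_on F U"
      using locally_injective by blast
    then have "inj_on f U" using fF inj_on_cong[of U f F] by blast
    with U show "\<exists>U. open U \<and> z \<in> U \<and> U \<subseteq> \<bbbD> \<and> inj_on f U" by blast
  qed
  have inH: "f \<in> \<H>" using assms(1) unfolding harmonic_class_def by blast
  have "\<forall>\<zeta>\<in>\<bbbD>. \<forall>b\<in>\<bbbD>. \<zeta> \<noteq> b \<longrightarrow> absolute_convexity_ineq h g \<zeta> b" if AK: "f \<in> AK_H"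
  proof (intro ballI impI)
    fix \<zeta> b assume "\<zeta> \<in> \<bbbD>" "b \<in> \<bbbD>" and ne: "\<zeta> \<noteq> b"
    then have \<zeta>b: "cmod \<zeta> < 1" "cmod b < 1" by auto
    define a where "a = euclidean_centre b \<zeta>"
    have in_disc: "cmod a + cmod (\<zeta> - a) < 1" unfolding a_def by (rule euclidean_circle_in_disc[OF \<zeta>b])
    have "absolute_convexity_ineq h g \<zeta> b \<longleftrightarrow> 0 \<le> curvature_form h g \<zeta> (\<zeta> - a)"
      unfolding a_def by (rule absolute_convexity_ineq_iff[OF \<zeta>b ne])
    moreover have "0 \<le> curvature_form h g \<zeta> (\<zeta> - a)"
    proof (cases "\<zeta> = a")
      case True
      then show ?thesis by (simp add: curvature_form_def)
    next
      case False
      show ?thesis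
      proof (rule curvature_form_nonneg[OF ball])
        have "cmod a < 1" using in_disc norm_ge_zero[of "\<zeta> - a"] by linarith
        then have "\<forall>r\<in>{0<..<1 - cmod a}. convex (f ` sub_disc a r)"
          using AK unfolding AK_H_def by simp
        then show "convex (F ` ball a r)" if "0 < r" "r < 1 - cmod a" for r
          using that image[of r a] by (metis greaterThanLessThan_iff less_imp_le)
        show "dist a \<zeta> < 1 - cmod a" using in_disc by (simp add: dist_norm norm_minus_commute)
      qed (fact False)
    qed
    ultimately show "absolute_convexity_ineq h g \<zeta> b" by blast
  qed
  moreover have "f \<in> AK_H_tilde"
    if ineq: "\<forall>\<zeta>\<in>\<bbbD>. \<forall>b\<in>\<bbbD>. \<zeta> \<noteq> b \<longrightarrow> absolute_convexity_ineq h g \<zeta> b"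
  proof -
    have nonneg: "0 \<le> curvature_form h g \<zeta> (\<zeta> - a)" if in_disc: "cmod a + cmod (\<zeta> - a) < 1" for a \<zeta>
    proof (cases "\<zeta> = a")
      case True
      then show ?thesis by (simp add: curvature_form_def)
    next
      case False
      obtain b where b: "cmod b < 1" "euclidean_centre b \<zeta> = a"
        using euclidean_centre_surj[OF in_disc] by blast
      have \<zeta>: "cmod \<zeta> < 1" using in_disc norm_triangle_ineq[of a "\<zeta> - a"] by simp
      have "\<zeta> \<noteq> b" using diff_euclidean_centre[OF \<zeta> b(1)] b(2) False by auto
      have "absolute_convexity_ineq h g \<zeta> b" using \<open>\<zeta> \<noteq> b\<close> ineq \<zeta> b(1) by blast
      then show ?thesis
        unfolding absolute_convexity_ineq_iff[OF \<zeta> b(1) \<open>\<zeta> \<noteq> b\<close>] b(2) .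
    qed
    have conv: "convex (F ` ball a r)" if r: "r \<le> 1 - cmod a" for a r
    proof (intro convex_image_ball_of_cballs convex_images_of_curvature_pos[OF ball])
      fix z assume z: "z \<in> ball a (1 - cmod a)" "z \<noteq> a"
      define u where "u = cmod (z - a)"
      have u: "0 < u" "u < 1 - cmod a"
        using z by (auto simp: u_def dist_norm norm_minus_commute)
      \<comment> \<open>The circle of radius \<open>v\<close> through \<open>z\<close>, tangent to the given one, has its centre at distance at
        most \<open>|a| + v - u\<close> from \<open>0\<close>. So it lies in the disc if \<open>|a| + 2 * v - u < 1\<close>.\<close>
      obtain v where v: "u < v" "v < (u + (1 - cmod a)) / 2" using dense[of u "(u + (1 - cmod a)) / 2"] u(2) by auto
      have "0 \<le> curvature_form h g z (of_real (v / u) * (z - a))"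
      proof -
        define c where "c = z - of_real (v / u) * (z - a)"
        have "cmod (z - c) = v" using u v by (simp add: c_def norm_mult norm_divide u_def[symmetric])
        moreover have "cmod c \<le> cmod a + (v - u)"
        proof -
          have "c = a + of_real (1 - v / u) * (z - a)" by (simp add: c_def algebra_simps)
          then have "cmod c \<le> cmod a + cmod (of_real (1 - v / u) * (z - a))"
            by (simp only: norm_triangle_ineq)
          also have "cmod (of_real (1 - v / u) * (z - a)) = \<bar>1 - v / u\<bar> * u"
            by (simp only: norm_mult norm_of_real u_def)
          also have "\<dots> = v - u" using u v by (simp add: abs_if field_simps)
          finally show ?thesis by simp
        qed
        ultimately have "cmod c + cmod (z - c) < 1" using v by argo
        from nonneg[OF this] show ?thesis by (simp add: c_def)
      qed
      then show "0 < curvature_form h g z (z - a)"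
        using z(2) jacobian_pos ball[of a] z(1) u(1) v(1)
        by (intro curvature_form_pos_of_larger_circle[of z a h g "v / u"]) auto
    qed (use r in auto)
    show ?thesis
      unfolding AK_H_tilde_def AK_H_def using inH lu conv image by auto
  qed
  moreover have "f \<in> AK_H" if "f \<in> AK_H_tilde" using that unfolding AK_H_tilde_def by blast
  ultimately show ?thesis by blast
qed

end
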